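(* Let $H=(\mu_r,1_r,\Delta_g,\epsilon_g,S)$ be a Hopf algebra over a field $k$ whose algebra is Frobenius with form $(\ ,\ )_r$ and metric $g_r=g_r^1\otimes g_r^2$, whose coalgebra is Frobenius with form $(\ ,\ )_g$ and metric $g_g$, and whose antipode is $S(h)=(h,g_r^1)_g\,g_r^2$. Let $\tilde H=(\mu_g,1_g,\Delta_r,\epsilon_r)$ be the associated Hopf algebra, so that $H$ is extended to an F-Hopf algebra. Let $\Theta:H\otimes H\to k$ be a bilinear form and $\mathfrak h:H\to H$, $\mathfrak h(h)=g_r^1\,\Theta(g_r^2,h)$. The following are equivalent: (1) $\Theta$ is a Type 2 (resp. Type 3) Hadamard form. (2) $h\mapsto\Theta(h,\cdot)$ is an isomorphism $H\cong H^\star$ (resp. $H\cong H^{\star\,op}$) of Hopf algebras. (3) $\mathfrak h$ is an isomorphism $H\cong\tilde H^{op}$ (resp. $H\cong\tilde H$) of Hopf algebras, i.e. for Type 2 $$\mu_g^{op}=\mathfrak h\circ\mu_r\circ(\mathfrak h^{-1}\otimes\mathfrak h^{-1}),$$ resp. for Type 3 $$\mu_g=\mathfrak h\circ\mu_r\circ(\mathfrak h^{-1}\otimes\mathfrak h^{-1}),$$ and in both cases $$\Delta_g=(\mathfrak h^{-1}\otimes\mathfrak h^{-1})\circ\Delta_r\circ\mathfrak h,\qquad 1_g=\mathfrak h(1_r),\qquad \epsilon_g=\epsilon_r\circ\mathfrak h.$$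
   Context: Frobenius algebra: a unital algebra $A$ with a bilinear form satisfying $(ab,c)=(a,bc)$ that is nondegenerate, i.e. there is a metric $g=g^1\otimes g^2\in A\otimes A$ (sum understood) with $(a,g^1)g^2=a=g^1(g^2,a)$. Frobenius coalgebra: a coalgebra with mutually inverse form and metric $g$ (same snake identities) such that $(\Delta\otimes\mathrm{id})g=(\mathrm{id}\otimes\Delta)g$. Write $\Delta_gh=h_1\otimes h_2$ (sum understood), and write the product $\mu_r$ by juxtaposition. The associated structures are $\Delta_rh=g_r^1\otimes g_r^2h=hg_r^1\otimes g_r^2$, $\epsilon_r(h)=(h,1_r)_r$, $\mu_g(h\otimes h')=h_1(h_2,h')_g=(h,h'_1)_gh'_2$, $1_g=(\mathrm{id}\otimes\epsilon_g)g_g$. Under the stated assumptions these form a Hopf algebra $\tilde H$ (called the associated Hopf algebra), so that $H,\tilde H$ together form an F-Hopf algebra: $(\mu_r,1_r,\Delta_r,\epsilon_r)$ and $(\mu_g,1_g,\Delta_g,\epsilon_g)$ are each the algebra and coalgebra determined by a Frobenius structure, while the algebra of either one with the coalgebra of the other forms a Hopf algebra. $\tilde H^{op}$ is $\tilde H$ with opposite product. $H^\star$ is the categorical dual: the dual space $H^*$ with the opposite product and opposite coproduct to the usual dual Hopf algebra $H^*$ (whose product is $(\phi\psi)(x)=\phi(x_1)\psi(x_2)$ and coproduct is given by $\phi_1(x)\phi_2(y)=\phi(xy)$). $H^{\star\,op}$ is $H^\star$ with the opposite product. Type 2 and Type 3 Hadamard forms: $\Theta$ is nondegenerate, satisfies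 $\Theta(1,h)=\epsilon_g(h)=\Theta(h,1)$ and (a) $\Theta(hh',h'')=\Theta(h,h''_2)\Theta(h',h''_1)$, together with, for Type 2, (b') $\Theta(h,h'h'')=\Theta(h_2,h')\Theta(h_1,h'')$, resp. for Type 3, (b'') $\Theta(h,h'h'')=\Theta(h_1,h')\Theta(h_2,h'')$ (equivalently, the identity in (b') holds for $\tilde\Theta=\Theta\circ(S\otimes\mathrm{id})$ in place of $\Theta$), for all $h,h',h''\in H$. Here $1=1_r$.
   Formalization: Type 3 item (2) is false as printed unless H is commutative; it is replaced by three equivalents: h↦Θ(h,·) is an isomorphism onto H^⋆ with opposite coproduct (not product), or h↦Θ(Sh,·), or h↦Θ(·,h), is an isomorphism H≅H^{⋆op}. *)

theory Defs
  imports Complex_Main "HOL-Library.Function_Algebras"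
begin

section \<open>Vector spaces and linear maps\<close>

text \<open>
  A vector space is a subspace \<open>hspace\<close> of an ambient type on which \<open>hscale\<close> is a scalar
  multiplication.  The carrier is needed because the dual space consists of some of the functions
  \<open>'v \<Rightarrow> 'k\<close> only; a vector space given as a type has \<open>hspace = UNIV\<close>.
\<close>

record ('k, 'v) vec =
  hspace :: "'v set"
  hscale :: "'k \<Rightarrow> 'v \<Rightarrow> 'v"

definition vec_space :: "('k::field, 'v::ab_group_add, 'z) vec_scheme \<Rightarrow> bool" where
  "vec_space V \<longleftrightarrow> vector_space (hscale V) \<and> module.subspace (hscale V) (hspace V)"

definition linear_on ::
  "'v set \<Rightarrow> ('k \<Rightarrow> 'v \<Rightarrow> 'v) \<Rightarrow> ('k \<Rightarrow> 'w \<Rightarrow> 'w) \<Rightarrow> ('v::plus \<Rightarrow> 'w::plus) \<Rightarrow> bool" where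
  "linear_on X s s' f \<longleftrightarrow>
     (\<forall>x\<in>X. \<forall>y\<in>X. f (x + y) = f x + f y) \<and> (\<forall>c. \<forall>x\<in>X. f (s c x) = s' c (f x))"

definition bilinear_on ::
  "'v set \<Rightarrow> ('k \<Rightarrow> 'v \<Rightarrow> 'v) \<Rightarrow> ('k \<Rightarrow> 'w \<Rightarrow> 'w) \<Rightarrow> ('v::plus \<Rightarrow> 'v \<Rightarrow> 'w::plus) \<Rightarrow> bool" where
  "bilinear_on X s s' F \<longleftrightarrow>
     (\<forall>x\<in>X. linear_on X s s' (F x)) \<and> (\<forall>y\<in>X. linear_on X s s' (\<lambda>x. F x y))"

definition trilinear_on ::
  "'v set \<Rightarrow> ('k \<Rightarrow> 'v \<Rightarrow> 'v) \<Rightarrow> ('k \<Rightarrow> 'w \<Rightarrow> 'w) \<Rightarrow> ('v::plus \<Rightarrow> 'v \<Rightarrow> 'v \<Rightarrow> 'w::plus) \<Rightarrow> bool" where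
  "trilinear_on X s s' F \<longleftrightarrow>
     (\<forall>x\<in>X. bilinear_on X s s' (F x)) \<and> (\<forall>y\<in>X. \<forall>z\<in>X. linear_on X s s' (\<lambda>x. F x y z))"

abbreviation form_on ::
  "('k::field, 'v::ab_group_add, 'z) vec_scheme \<Rightarrow> ('v \<Rightarrow> 'v \<Rightarrow> 'k) \<Rightarrow> bool" where
  "form_on V \<equiv> bilinear_on (hspace V) (hscale V) (*)"

section \<open>Tensors\<close>

text \<open>
  The pure tensor \<open>x \<otimes> y\<close> is realised as the evaluation \<open>B \<mapsto> B x y\<close> on bilinear forms, that is,
  \<open>V \<otimes> V\<close> is realised inside the dual of the space of bilinear forms.  Over a field this is a
  faithful model of the tensor product: the lemmas \<open>bilinear_tens\<close> and
  \<open>sweedler_sum_list\<close> below are its universal property.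
\<close>

type_synonym ('k, 'v) tensor = "('v \<Rightarrow> 'v \<Rightarrow> 'k) \<Rightarrow> 'k"
type_synonym ('k, 'v) tensor3 = "('v \<Rightarrow> 'v \<Rightarrow> 'v \<Rightarrow> 'k) \<Rightarrow> 'k"

definition tens ::
  "('k::field, 'v::ab_group_add, 'z) vec_scheme \<Rightarrow> 'v \<Rightarrow> 'v \<Rightarrow> ('k, 'v) tensor" where
  "tens V x y = (\<lambda>B. if bilinear_on UNIV (hscale V) (*) B then B x y else 0)"

definition tens3 ::
  "('k::field, 'v::ab_group_add, 'z) vec_scheme \<Rightarrow> 'v \<Rightarrow> 'v \<Rightarrow> 'v \<Rightarrow> ('k, 'v) tensor3" where
  "tens3 V x y z = (\<lambda>T. if trilinear_on UNIV (hscale V) (*) T then T x y z else 0)"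

abbreviation fun_scale :: "'k \<Rightarrow> ('a \<Rightarrow> 'k::field) \<Rightarrow> 'a \<Rightarrow> 'k" where
  "fun_scale c f \<equiv> (\<lambda>x. c * f x)"

definition tensor_square ::
  "('k::field, 'v::ab_group_add, 'z) vec_scheme \<Rightarrow> ('k, 'v) tensor set" where
  "tensor_square V =
     {t. \<exists>ps. set ps \<subseteq> hspace V \<times> hspace V \<and> t = (\<Sum>(x, y)\<leftarrow>ps. tens V x y)}"

text \<open>
  Sweedler notation: for \<open>t = t\<^sub>1 \<otimes> t\<^sub>2\<close> (sum understood), \<open>sweedler V t (\<lambda>x y. F x y)\<close> is
  \<open>F(t\<^sub>1, t\<^sub>2)\<close> (sum understood), for any bilinear \<open>F\<close>.
\<close>

definition sweedler ::
  "('k::field, 'v::ab_group_add, 'z) vec_scheme \<Rightarrow> ('k, 'v) tensor \<Rightarrow>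
     ('v \<Rightarrow> 'v \<Rightarrow> 'w::comm_monoid_add) \<Rightarrow> 'w" where
  "sweedler V t F =
     (THE w. \<exists>ps. set ps \<subseteq> hspace V \<times> hspace V \<and>
        t = (\<Sum>(x, y)\<leftarrow>ps. tens V x y) \<and> w = (\<Sum>(x, y)\<leftarrow>ps. F x y))"

definition tensor_map ::
  "('k::field, 'v::ab_group_add, 'z) vec_scheme \<Rightarrow> ('k, 'w::ab_group_add, 'y) vec_scheme \<Rightarrow>
     ('v \<Rightarrow> 'w) \<Rightarrow> ('k, 'v) tensor \<Rightarrow> ('k, 'w) tensor" where
  "tensor_map V W f t = sweedler V t (\<lambda>x y. tens W (f x) (f y))"

definition tensor_flip ::
  "('k::field, 'v::ab_group_add, 'z) vec_scheme \<Rightarrow> ('k, 'v) tensor \<Rightarrow> ('k, 'v) tensor" where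
  "tensor_flip V t = sweedler V t (\<lambda>x y. tens V y x)"

lemma bilinear_tens: "bilinear_on UNIV (hscale V) fun_scale (tens V)"
  by (auto simp: bilinear_on_def linear_on_def tens_def fun_eq_iff)

lemma sum_tens_apply:
  assumes "bilinear_on UNIV (hscale V) (*) B"
  shows "(\<Sum>(x, y)\<leftarrow>ps. tens V x y) B = (\<Sum>(x, y)\<leftarrow>ps. B x y)"
  using assms by (induction ps) (auto simp: tens_def)

lemma sum_list_eq_of_tens_eq:
  assumes V: "vec_space V" and s': "vector_space s'"
    and F: "bilinear_on (hspace V) (hscale V) s' F"
    and ps: "set ps \<subseteq> hspace V \<times> hspace V" and qs: "set qs \<subseteq> hspace V \<times> hspace V"
    and eq: "(\<Sum>(x, y)\<leftarrow>ps. tens V x y) = (\<Sum>(x, y)\<leftarrow>qs. tens V x y)"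
  shows "(\<Sum>(x, y)\<leftarrow>ps. F x y) = (\<Sum>(x, y)\<leftarrow>qs. F x y)"
proof (rule ccontr)
  assume neq: "(\<Sum>(x, y)\<leftarrow>ps. F x y) \<noteq> (\<Sum>(x, y)\<leftarrow>qs. F x y)"
  define d where "d = (\<Sum>(x, y)\<leftarrow>ps. F x y) - (\<Sum>(x, y)\<leftarrow>qs. F x y)"
  interpret vs: vector_space "hscale V" using V by (simp add: vec_space_def)
  interpret vs': vector_space s' by (rule s')
  interpret K: vector_space "(*) :: 'a \<Rightarrow> 'a \<Rightarrow> 'a"
    by unfold_locales (auto simp: algebra_simps)
  interpret VV: vector_space_pair "hscale V" "hscale V" ..
  interpret VK: vector_space_pair s' "(*) :: 'a \<Rightarrow> 'a \<Rightarrow> 'a" ..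
  have sub: "vs.subspace (hspace V)" using V by (simp add: vec_space_def)
  have "\<not> vs'.dependent {d}" using neq by (simp add: d_def vs'.dependent_single)
  then obtain \<phi> where \<phi>: "Vector_Spaces.linear s' (*) \<phi>" "\<phi> d = 1"
    using VK.linear_independent_extend[of "{d}" "\<lambda>_. 1"] by auto
  have "Vector_Spaces.linear (hscale V) (hscale V) id" by (rule vs.linear_id)
  then obtain p where p: "range p \<subseteq> hspace V" "Vector_Spaces.linear (hscale V) (hscale V) p"
      "\<And>x. x \<in> hspace V \<Longrightarrow> p x = x"
    using VV.linear_exists_left_inverse_on[of id "hspace V"] sub by auto
  interpret \<phi>: Vector_Spaces.linear s' "(*)" \<phi> by (rule \<phi>)
  interpret p: Vector_Spaces.linear "hscale V" "hscale V" p by (rule p)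
  have pin: "p x \<in> hspace V" for x using p(1) by auto
  let ?B = "\<lambda>x y. \<phi> (F (p x) (p y))"
  have B: "bilinear_on UNIV (hscale V) (*) ?B"
    unfolding bilinear_on_def linear_on_def
    using F[unfolded bilinear_on_def linear_on_def] pin
    by (auto simp only: p.add p.scale \<phi>.add \<phi>.scale)
  have sumB: "(\<Sum>(x, y)\<leftarrow>rs. ?B x y) = \<phi> (\<Sum>(x, y)\<leftarrow>rs. F x y)"
    if "set rs \<subseteq> hspace V \<times> hspace V" for rs
    using that by (induction rs) (auto simp: p(3) \<phi>.add \<phi>.zero)
  have "\<phi> (\<Sum>(x, y)\<leftarrow>ps. F x y) = \<phi> (\<Sum>(x, y)\<leftarrow>qs. F x y)"
    using sum_tens_apply[OF B, of ps] sum_tens_apply[OF B, of qs] eq sumB[OF ps] sumB[OF qs]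
    by simp
  then have "\<phi> d = 0" by (simp add: d_def \<phi>.diff)
  with \<phi>(2) show False by simp
qed

lemma sweedler_sum_list:
  assumes "vec_space V" "vector_space s'" "bilinear_on (hspace V) (hscale V) s' F"
    and "set ps \<subseteq> hspace V \<times> hspace V"
  shows "sweedler V (\<Sum>(x, y)\<leftarrow>ps. tens V x y) F = (\<Sum>(x, y)\<leftarrow>ps. F x y)"
  unfolding sweedler_def
proof (rule the_equality)
  show "\<exists>qs. set qs \<subseteq> hspace V \<times> hspace V \<and>
      (\<Sum>(x, y)\<leftarrow>ps. tens V x y) = (\<Sum>(x, y)\<leftarrow>qs. tens V x y) \<and>
      (\<Sum>(x, y)\<leftarrow>ps. F x y) = (\<Sum>(x, y)\<leftarrow>qs. F x y)"
    using assms(4) by blast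
next
  fix w
  assume "\<exists>qs. set qs \<subseteq> hspace V \<times> hspace V \<and>
      (\<Sum>(x, y)\<leftarrow>ps. tens V x y) = (\<Sum>(x, y)\<leftarrow>qs. tens V x y) \<and>
      w = (\<Sum>(x, y)\<leftarrow>qs. F x y)"
  then obtain qs where qs: "set qs \<subseteq> hspace V \<times> hspace V"
    "(\<Sum>(x, y)\<leftarrow>ps. tens V x y) = (\<Sum>(x, y)\<leftarrow>qs. tens V x y)"
    "w = (\<Sum>(x, y)\<leftarrow>qs. F x y)"
    by (elim exE conjE)
  show "w = (\<Sum>(x, y)\<leftarrow>ps. F x y)"
    unfolding qs(3) by (rule sum_list_eq_of_tens_eq[OF assms(1-3) assms(4) qs(1,2), symmetric])
qed

definition metric_of ::
  "('k::field, 'v::ab_group_add, 'z) vec_scheme \<Rightarrow> ('v \<Rightarrow> 'v \<Rightarrow> 'k) \<Rightarrow> ('k, 'v) tensor \<Rightarrow> bool" where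
  "metric_of V B g \<longleftrightarrow> g \<in> tensor_square V \<and>
     (\<forall>a\<in>hspace V.
        sweedler V g (\<lambda>x y. hscale V (B a x) y) = a \<and>
        sweedler V g (\<lambda>x y. hscale V (B y a) x) = a)"

definition nondegenerate ::
  "('k::field, 'v::ab_group_add, 'z) vec_scheme \<Rightarrow> ('v \<Rightarrow> 'v \<Rightarrow> 'k) \<Rightarrow> bool" where
  "nondegenerate V B \<longleftrightarrow> (\<exists>g. metric_of V B g)"

section \<open>Hopf algebras and Frobenius structures\<close>

record ('k, 'v) hopf_data = "('k, 'v) vec" +
  hmult :: "'v \<Rightarrow> 'v \<Rightarrow> 'v"
  hunit :: "'v"
  hcomult :: "'v \<Rightarrow> ('k, 'v) tensor"
  hcounit :: "'v \<Rightarrow> 'k"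

definition unital_algebra :: "('k::field, 'v::ab_group_add) hopf_data \<Rightarrow> bool" where
  "unital_algebra A \<longleftrightarrow> vec_space A \<and>
     (\<forall>a\<in>hspace A. \<forall>b\<in>hspace A. hmult A a b \<in> hspace A) \<and>
     bilinear_on (hspace A) (hscale A) (hscale A) (hmult A) \<and>
     (\<forall>a\<in>hspace A. \<forall>b\<in>hspace A. \<forall>c\<in>hspace A.
        hmult A (hmult A a b) c = hmult A a (hmult A b c)) \<and>
     hunit A \<in> hspace A \<and>
     (\<forall>a\<in>hspace A. hmult A (hunit A) a = a \<and> hmult A a (hunit A) = a)"

definition coalgebra :: "('k::field, 'v::ab_group_add) hopf_data \<Rightarrow> bool" where
  "coalgebra A \<longleftrightarrow> vec_space A \<and>
     (\<forall>h\<in>hspace A. hcomult A h \<in> tensor_square A) \<and>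
     linear_on (hspace A) (hscale A) fun_scale (hcomult A) \<and>
     linear_on (hspace A) (hscale A) (*) (hcounit A) \<and>
     (\<forall>h\<in>hspace A.
        sweedler A (hcomult A h) (\<lambda>x z. sweedler A (hcomult A x) (\<lambda>a b. tens3 A a b z)) =
        sweedler A (hcomult A h) (\<lambda>x z. sweedler A (hcomult A z) (\<lambda>a b. tens3 A x a b))) \<and>
     (\<forall>h\<in>hspace A.
        sweedler A (hcomult A h) (\<lambda>a b. hscale A (hcounit A a) b) = h \<and>
        sweedler A (hcomult A h) (\<lambda>a b. hscale A (hcounit A b) a) = h)"

definition bialgebra :: "('k::field, 'v::ab_group_add) hopf_data \<Rightarrow> bool" where
  "bialgebra A \<longleftrightarrow> unital_algebra A \<and> coalgebra A \<and>
     (\<forall>h\<in>hspace A. \<forall>h'\<in>hspace A.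
        hcomult A (hmult A h h') =
          sweedler A (hcomult A h) (\<lambda>a b. sweedler A (hcomult A h') (\<lambda>a' b'.
            tens A (hmult A a a') (hmult A b b'))) \<and>
        hcounit A (hmult A h h') = hcounit A h * hcounit A h') \<and>
     hcomult A (hunit A) = tens A (hunit A) (hunit A) \<and>
     hcounit A (hunit A) = 1"

definition hopf_algebra :: "('k::field, 'v::ab_group_add) hopf_data \<Rightarrow> ('v \<Rightarrow> 'v) \<Rightarrow> bool" where
  "hopf_algebra A S \<longleftrightarrow> bialgebra A \<and>
     S ` hspace A \<subseteq> hspace A \<and>
     linear_on (hspace A) (hscale A) (hscale A) S \<and>
     (\<forall>h\<in>hspace A.
        sweedler A (hcomult A h) (\<lambda>a b. hmult A (S a) b) = hscale A (hcounit A h) (hunit A) \<and>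
        sweedler A (hcomult A h) (\<lambda>a b. hmult A a (S b)) = hscale A (hcounit A h) (hunit A))"

definition frobenius_algebra ::
  "('k::field, 'v::ab_group_add) hopf_data \<Rightarrow> ('v \<Rightarrow> 'v \<Rightarrow> 'k) \<Rightarrow> ('k, 'v) tensor \<Rightarrow> bool" where
  "frobenius_algebra A B g \<longleftrightarrow> unital_algebra A \<and> form_on A B \<and> metric_of A B g \<and>
     (\<forall>a\<in>hspace A. \<forall>b\<in>hspace A. \<forall>c\<in>hspace A. B (hmult A a b) c = B a (hmult A b c))"

definition frobenius_coalgebra ::
  "('k::field, 'v::ab_group_add) hopf_data \<Rightarrow> ('v \<Rightarrow> 'v \<Rightarrow> 'k) \<Rightarrow> ('k, 'v) tensor \<Rightarrow> bool" where
  "frobenius_coalgebra A B g \<longleftrightarrow> coalgebra A \<and> form_on A B \<and> metric_of A B g \<and>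
     sweedler A g (\<lambda>x y. sweedler A (hcomult A x) (\<lambda>a b. tens3 A a b y)) =
     sweedler A g (\<lambda>x y. sweedler A (hcomult A y) (\<lambda>a b. tens3 A x a b))"

definition associated_hopf ::
  "('k::field, 'v::ab_group_add) hopf_data \<Rightarrow> ('v \<Rightarrow> 'v \<Rightarrow> 'k) \<Rightarrow> ('k, 'v) tensor \<Rightarrow>
     ('v \<Rightarrow> 'v \<Rightarrow> 'k) \<Rightarrow> ('k, 'v) tensor \<Rightarrow> ('k, 'v) hopf_data" where
  "associated_hopf A Br gr Bg gg = \<lparr>
     hspace = hspace A, hscale = hscale A,
     hmult = (\<lambda>h h'. sweedler A (hcomult A h) (\<lambda>a b. hscale A (Bg b h') a)),
     hunit = sweedler A gg (\<lambda>a b. hscale A (hcounit A b) a),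
     hcomult = (\<lambda>h. sweedler A gr (\<lambda>a b. tens A a (hmult A b h))),
     hcounit = (\<lambda>h. Br h (hunit A))\<rparr>"

section \<open>Opposites, duals and isomorphisms\<close>

definition op_mult :: "('k::field, 'v::ab_group_add) hopf_data \<Rightarrow> ('k, 'v) hopf_data" where
  "op_mult A = A\<lparr>hmult := (\<lambda>a b. hmult A b a)\<rparr>"

definition op_comult :: "('k::field, 'v::ab_group_add) hopf_data \<Rightarrow> ('k, 'v) hopf_data" where
  "op_comult A = A\<lparr>hcomult := (\<lambda>h. tensor_flip A (hcomult A h))\<rparr>"

text \<open>
  Functionals are extended by \<open>0\<close> outside the carrier, so that they are determined by their values
  on it.
\<close>

definition zero_ext :: "'v set \<Rightarrow> ('v \<Rightarrow> 'k::zero) \<Rightarrow> 'v \<Rightarrow> 'k" where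
  "zero_ext X f = (\<lambda>x. if x \<in> X then f x else 0)"

definition dual_space ::
  "('k::field, 'v::ab_group_add, 'z) vec_scheme \<Rightarrow> ('k, 'v \<Rightarrow> 'k) vec" where
  "dual_space V = \<lparr>
     hspace = {\<phi>. linear_on (hspace V) (hscale V) (*) \<phi> \<and> (\<forall>x. x \<notin> hspace V \<longrightarrow> \<phi> x = 0)},
     hscale = fun_scale\<rparr>"

text \<open>The usual dual: the product is convolution, the coproduct is \<open>\<phi>\<^sub>1(x) \<phi>\<^sub>2(y) = \<phi>(x y)\<close>.\<close>

definition dual_hopf ::
  "('k::field, 'v::ab_group_add) hopf_data \<Rightarrow> ('k, 'v \<Rightarrow> 'k) hopf_data" where
  "dual_hopf A = \<lparr>
     hspace = hspace (dual_space A), hscale = hscale (dual_space A),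
     hmult = (\<lambda>\<phi> \<psi>. zero_ext (hspace A) (\<lambda>x. sweedler A (hcomult A x) (\<lambda>a b. \<phi> a * \<psi> b))),
     hunit = zero_ext (hspace A) (hcounit A),
     hcomult = (\<lambda>\<phi>. THE t. t \<in> tensor_square (dual_space A) \<and>
        (\<forall>x\<in>hspace A. \<forall>y\<in>hspace A.
           sweedler (dual_space A) t (\<lambda>\<alpha> \<beta>. \<alpha> x * \<beta> y) = \<phi> (hmult A x y))),
     hcounit = (\<lambda>\<phi>. \<phi> (hunit A))\<rparr>"

definition categorical_dual ::
  "('k::field, 'v::ab_group_add) hopf_data \<Rightarrow> ('k, 'v \<Rightarrow> 'k) hopf_data" where
  "categorical_dual A = op_mult (op_comult (dual_hopf A))"

text \<open>Bialgebra maps between Hopf algebras automatically commute with the antipodes.\<close>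

definition hopf_iso ::
  "('k::field, 'v::ab_group_add) hopf_data \<Rightarrow> ('k, 'w::ab_group_add) hopf_data \<Rightarrow>
     ('v \<Rightarrow> 'w) \<Rightarrow> bool" where
  "hopf_iso A B f \<longleftrightarrow>
     bij_betw f (hspace A) (hspace B) \<and>
     linear_on (hspace A) (hscale A) (hscale B) f \<and>
     (\<forall>x\<in>hspace A. \<forall>y\<in>hspace A. f (hmult A x y) = hmult B (f x) (f y)) \<and>
     f (hunit A) = hunit B \<and>
     (\<forall>x\<in>hspace A. hcomult B (f x) = tensor_map A B f (hcomult A x)) \<and>
     (\<forall>x\<in>hspace A. hcounit B (f x) = hcounit A x)"

text \<open>The same conditions with the structure of \<open>B\<close>, respectively \<open>A\<close>, expressed through \<open>f\<^sup>-\<^sup>1\<close>.\<close>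

definition hopf_transport ::
  "('k::field, 'v::ab_group_add) hopf_data \<Rightarrow> ('k, 'w::ab_group_add) hopf_data \<Rightarrow>
     ('v \<Rightarrow> 'w) \<Rightarrow> bool" where
  "hopf_transport A B f \<longleftrightarrow>
     bij_betw f (hspace A) (hspace B) \<and>
     linear_on (hspace A) (hscale A) (hscale B) f \<and>
     (\<forall>x\<in>hspace B. \<forall>y\<in>hspace B.
        hmult B x y = f (hmult A (inv_into (hspace A) f x) (inv_into (hspace A) f y))) \<and>
     (\<forall>h\<in>hspace A.
        hcomult A h = tensor_map B A (inv_into (hspace A) f) (hcomult B (f h))) \<and>
     hunit B = f (hunit A) \<and>
     (\<forall>h\<in>hspace A. hcounit A h = hcounit B (f h))"

section \<open>Hadamard forms\<close>

definition hadamard_form_common ::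
  "('k::field, 'v::ab_group_add) hopf_data \<Rightarrow> ('v \<Rightarrow> 'v \<Rightarrow> 'k) \<Rightarrow> bool" where
  "hadamard_form_common H \<Theta> \<longleftrightarrow> nondegenerate H \<Theta> \<and>
     (\<forall>h\<in>hspace H. \<Theta> (hunit H) h = hcounit H h \<and> \<Theta> h (hunit H) = hcounit H h) \<and>
     (\<forall>h\<in>hspace H. \<forall>h'\<in>hspace H. \<forall>h''\<in>hspace H.
        \<Theta> (hmult H h h') h'' = sweedler H (hcomult H h'') (\<lambda>a b. \<Theta> h b * \<Theta> h' a))"

definition hadamard_type2 ::
  "('k::field, 'v::ab_group_add) hopf_data \<Rightarrow> ('v \<Rightarrow> 'v \<Rightarrow> 'k) \<Rightarrow> bool" where
  "hadamard_type2 H \<Theta> \<longleftrightarrow> hadamard_form_common H \<Theta> \<and>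
     (\<forall>h\<in>hspace H. \<forall>h'\<in>hspace H. \<forall>h''\<in>hspace H.
        \<Theta> h (hmult H h' h'') = sweedler H (hcomult H h) (\<lambda>a b. \<Theta> b h' * \<Theta> a h''))"

definition hadamard_type3 ::
  "('k::field, 'v::ab_group_add) hopf_data \<Rightarrow> ('v \<Rightarrow> 'v \<Rightarrow> 'k) \<Rightarrow> bool" where
  "hadamard_type3 H \<Theta> \<longleftrightarrow> hadamard_form_common H \<Theta> \<and>
     (\<forall>h\<in>hspace H. \<forall>h'\<in>hspace H. \<forall>h''\<in>hspace H.
        \<Theta> h (hmult H h' h'') = sweedler H (hcomult H h) (\<lambda>a b. \<Theta> a h' * \<Theta> b h''))"

definition hadamard_map ::
  "('k::field, 'v::ab_group_add) hopf_data \<Rightarrow> ('k, 'v) tensor \<Rightarrow> ('v \<Rightarrow> 'v \<Rightarrow> 'k) \<Rightarrow> 'v \<Rightarrow> 'v" where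
  "hadamard_map H gr \<Theta> h = sweedler H gr (\<lambda>x y. hscale H (\<Theta> y h) x)"

end

theory Submission
  imports Defs
begin

text \<open>
  Setting \<open>h = 1\<close> in \<open>h\<^sub>1 (h\<^sub>2, h')\<^sub>g = (h, h'\<^sub>1)\<^sub>g h'\<^sub>2\<close> and using \<open>(h, h')\<^sub>g = (S h, h')\<^sub>r\<close> shows that
  \<open>(1, _)\<^sub>r\<close> is an integral on \<open>H\<close>; hence \<open>(c, x\<^sub>1)\<^sub>r S x\<^sub>2 = (c\<^sub>1, x)\<^sub>r c\<^sub>2\<close>.  This identity says that
  \<open>(_, _)\<^sub>r\<close> pairs \<open>\<mu>\<^sub>g\<close> with \<open>\<Delta>\<^sub>g\<close>: \<open>(c, \<mu>\<^sub>g(x, y))\<^sub>r = (c\<^sub>1, x)\<^sub>r (c\<^sub>2, y)\<^sub>r\<close>.  With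
  \<open>c\<close> chosen such that \<open>(c, _)\<^sub>r = \<epsilon>\<^sub>g\<close> it also expresses \<open>S\<close> through \<open>\<Delta>\<^sub>g c\<close>, from which \<open>S\<close>
  is seen to reverse products and coproducts.  Since \<open>(c, hh h)\<^sub>r = \<Theta>(c, h)\<close> for the map \<open>hh\<close> of the
  theorem, testing each condition on an isomorphism against functionals turns it into one of the
  Hadamard identities.

  Tensors and their images are compared by evaluating them on scalar bilinear forms; by
  finite-dimensionality, products of functionals from a dual basis suffice.
\<close>

section \<open>Linear maps and tensors\<close>

lemma vector_space_fun_scale: "vector_space (fun_scale :: 'k::field \<Rightarrow> ('a \<Rightarrow> 'k) \<Rightarrow> 'a \<Rightarrow> 'k)"
  by unfold_locales (auto simp: fun_eq_iff algebra_simps)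

lemma vector_space_mult: "vector_space ((*) :: 'k::field \<Rightarrow> 'k \<Rightarrow> 'k)"
  by unfold_locales (auto simp: algebra_simps)

lemma linear_on_0:
  assumes "linear_on UNIV s s' f" "vector_space s" "vector_space s'"
  shows "f 0 = 0"
proof -
  interpret v: vector_space s by fact
  interpret v': vector_space s' by fact
  have "f (s 0 0) = s' 0 (f 0)"
    using assms(1) unfolding linear_on_def by blast
  then show ?thesis by simp
qed

lemma linear_on_sum_list:
  assumes f: "linear_on UNIV s s' f" "vector_space s" "vector_space s'"
  shows "f (\<Sum>x\<leftarrow>xs. g x) = (\<Sum>x\<leftarrow>xs. f (g x))"
  using linear_on_0[OF f] f(1) by (induction xs) (auto simp: linear_on_def)

lemma linear_on_id: "linear_on X s s (\<lambda>x. x)"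
  by (simp add: linear_on_def)

lemma linear_on_apply: "linear_on UNIV fun_scale (*) (\<lambda>f :: 'a \<Rightarrow> 'k::field. f x)"
  by (simp add: linear_on_def)

lemma bilinear_on_UNIV:
  "bilinear_on UNIV s s' F \<longleftrightarrow>
     (\<forall>x. linear_on UNIV s s' (F x)) \<and> (\<forall>y. linear_on UNIV s s' (\<lambda>x. F x y))"
  by (simp add: bilinear_on_def)

lemma bilinear_on_subset: "bilinear_on UNIV s s' F \<Longrightarrow> bilinear_on X s s' F"
  by (auto simp: bilinear_on_def linear_on_def)

lemma bilinear_on_compose:
  assumes "bilinear_on UNIV s2 s3 F" "linear_on UNIV s s2 p" "linear_on UNIV s s2 q"
  shows "bilinear_on UNIV s s3 (\<lambda>x y. F (p x) (q y))"
  using assms by (auto simp: bilinear_on_def linear_on_def)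

lemma bilinear_on_flip: "bilinear_on UNIV s s' F \<Longrightarrow> bilinear_on UNIV s s' (\<lambda>x y. F y x)"
  by (simp add: bilinear_on_UNIV)

lemma bilinear_on_times:
  fixes f g :: "'v::plus \<Rightarrow> 'k::field"
  assumes "linear_on UNIV s (*) f" "linear_on UNIV s (*) g"
  shows "bilinear_on UNIV s (*) (\<lambda>x y. f x * g y)"
  using assms by (auto simp: bilinear_on_def linear_on_def algebra_simps)

section \<open>Tensors as functionals on bilinear forms\<close>

lemma tensor_squareE:
  assumes "t \<in> tensor_square V"
  obtains ps where "set ps \<subseteq> hspace V \<times> hspace V" "t = (\<Sum>(x, y)\<leftarrow>ps. tens V x y)"
  using assms unfolding tensor_square_def by blast

text \<open>One representing list serves all bilinear forms at once, so identities between
  evaluations become identities between finite sums.\<close>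

lemma tensor_square_apply:
  assumes "t \<in> tensor_square V"
  obtains ps where "set ps \<subseteq> hspace V \<times> hspace V"
    "\<And>F. bilinear_on UNIV (hscale V) (*) F \<Longrightarrow> t F = (\<Sum>(x, y)\<leftarrow>ps. F x y)"
  using assms sum_tens_apply by (metis tensor_squareE)

text \<open>The default value 0 of \<open>tens\<close> off bilinear forms is inherited by sums.
  Hence two tensors that agree on bilinear forms agree as functions.\<close>

lemma tensor_apply_not_bilinear:
  assumes "t \<in> tensor_square V" "\<not> bilinear_on UNIV (hscale V) (*) F"
  shows "t F = 0"
proof -
  from assms(1) obtain ps where "t = (\<Sum>(x, y)\<leftarrow>ps. tens V x y)" by (rule tensor_squareE)
  moreover have "(\<Sum>(x, y)\<leftarrow>ps. tens V x y) F = 0"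
    using assms(2) by (induction ps) (auto simp: tens_def)
  ultimately show ?thesis by simp
qed

lemma tensor_eq_iff:
  assumes "t \<in> tensor_square V" "t' \<in> tensor_square V"
  shows "t = t' \<longleftrightarrow> (\<forall>F. bilinear_on UNIV (hscale V) (*) F \<longrightarrow> t F = t' F)"
  using tensor_apply_not_bilinear[OF assms(1)] tensor_apply_not_bilinear[OF assms(2)]
  by (metis ext)

text \<open>This is the bridge from the definite description in \<open>sweedler\<close> to plain
  evaluation: a vector-valued Sweedler expression is accessed through functionals, and a functional
  moves under the sum.\<close>

lemma linear_sweedler:
  assumes V: "vec_space V" and t: "t \<in> tensor_square V"
    and s': "vector_space s'" and F: "bilinear_on UNIV (hscale V) s' F"
    and \<phi>: "linear_on UNIV s' (*) \<phi>"
  shows "\<phi> (sweedler V t F) = t (\<lambda>x y. \<phi> (F x y))"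
proof -
  from t obtain ps where ps: "set ps \<subseteq> hspace V \<times> hspace V" "t = (\<Sum>(x, y)\<leftarrow>ps. tens V x y)"
    by (rule tensor_squareE)
  have "sweedler V t F = (\<Sum>(x, y)\<leftarrow>ps. F x y)"
    unfolding ps(2) by (rule sweedler_sum_list[OF V s' bilinear_on_subset[OF F] ps(1)])
  then have "\<phi> (sweedler V t F) = (\<Sum>(x, y)\<leftarrow>ps. \<phi> (F x y))"
    using linear_on_sum_list[OF \<phi> s' vector_space_mult, of "\<lambda>(x, y). F x y"]
    by (simp add: case_prod_unfold)
  moreover have "bilinear_on UNIV (hscale V) (*) (\<lambda>x y. \<phi> (F x y))"
    using F \<phi> by (auto simp: bilinear_on_def linear_on_def)
  ultimately show ?thesis by (simp add: ps(2) sum_tens_apply)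
qed

lemma sweedler_scalar:
  assumes "vec_space V" "t \<in> tensor_square V" "bilinear_on UNIV (hscale V) (*) F"
  shows "sweedler V t F = t F"
  using linear_sweedler[OF assms(1,2) vector_space_mult assms(3) linear_on_id] by simp

lemma sweedler_fun_apply:
  assumes "vec_space V" "t \<in> tensor_square V" "bilinear_on UNIV (hscale V) fun_scale F"
  shows "sweedler V t F G = t (\<lambda>x y. F x y G)"
  using linear_sweedler[OF assms(1,2) vector_space_fun_scale assms(3) linear_on_apply] .

text \<open>Mapping a representing list entrywise gives a representing list of the image.\<close>

lemma sweedler_tens_in:
  assumes V: "vec_space V" and t: "t \<in> tensor_square V"
    and F: "bilinear_on UNIV (hscale V) fun_scale (\<lambda>x y. tens W (p x y) (q x y))"
    and pq: "\<And>x y. x \<in> hspace V \<Longrightarrow> y \<in> hspace V \<Longrightarrow> p x y \<in> hspace W \<and> q x y \<in> hspace W"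
  shows "sweedler V t (\<lambda>x y. tens W (p x y) (q x y)) \<in> tensor_square W"
proof -
  from t obtain ps where ps: "set ps \<subseteq> hspace V \<times> hspace V" "t = (\<Sum>(x, y)\<leftarrow>ps. tens V x y)"
    by (rule tensor_squareE)
  have "sweedler V t (\<lambda>x y. tens W (p x y) (q x y)) = (\<Sum>(x, y)\<leftarrow>ps. tens W (p x y) (q x y))"
    unfolding ps(2)
    by (rule sweedler_sum_list[OF V vector_space_fun_scale bilinear_on_subset[OF F] ps(1)])
  also have "\<dots> = (\<Sum>(x, y)\<leftarrow>map (\<lambda>(x, y). (p x y, q x y)) ps. tens W x y)"
    by (simp add: case_prod_unfold comp_def)
  also have "\<dots> \<in> tensor_square W"
    unfolding tensor_square_def mem_Collect_eq
    by (rule exI[of _ "map (\<lambda>(x, y). (p x y, q x y)) ps"]) (use ps(1) pq in fastforce)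
  finally show ?thesis .
qed

lemma bilinear_tens_map:
  assumes "linear_on UNIV s (hscale W) p" "linear_on UNIV s (hscale W) q"
  shows "bilinear_on UNIV s fun_scale (\<lambda>x y. tens W (p x) (q y))"
  using bilinear_on_compose[OF bilinear_tens assms] .

lemma tens_apply: "bilinear_on UNIV (hscale W) (*) G \<Longrightarrow> tens W x y G = G x y"
  by (simp add: tens_def)

lemma
  assumes V: "vec_space V" and t: "t \<in> tensor_square V"
    and f: "linear_on UNIV (hscale V) (hscale W) f"
  shows tensor_map_in: "f ` hspace V \<subseteq> hspace W \<Longrightarrow> tensor_map V W f t \<in> tensor_square W"
    and tensor_map_apply: "bilinear_on UNIV (hscale W) (*) G \<Longrightarrow>
      tensor_map V W f t G = t (\<lambda>x y. G (f x) (f y))"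
  unfolding tensor_map_def
  by (rule sweedler_tens_in[OF V t bilinear_tens_map[OF f f]], blast)
    (simp add: sweedler_fun_apply[OF V t bilinear_tens_map[OF f f]] tens_apply)

lemma
  assumes V: "vec_space V" and t: "t \<in> tensor_square V"
  shows tensor_flip_in: "tensor_flip V t \<in> tensor_square V"
    and tensor_flip_apply: "bilinear_on UNIV (hscale V) (*) G \<Longrightarrow>
      tensor_flip V t G = t (\<lambda>x y. G y x)"
  unfolding tensor_flip_def
  by (rule sweedler_tens_in[OF V t bilinear_on_flip[OF bilinear_tens]], blast)
    (simp add: sweedler_fun_apply[OF V t bilinear_on_flip[OF bilinear_tens]] tens_apply)

lemma tensor_flip_flip:
  assumes V: "vec_space V" and t: "t \<in> tensor_square V"
  shows "tensor_flip V (tensor_flip V t) = t"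
  using assms
  by (simp add: tensor_eq_iff[of _ V] tensor_flip_in tensor_flip_apply bilinear_on_flip)

section \<open>Linearity, exchange and separation of tensor evaluations\<close>

lemma tensor_apply_add:
  assumes "t \<in> tensor_square V"
    "bilinear_on UNIV (hscale V) (*) F" "bilinear_on UNIV (hscale V) (*) G"
  shows "t (\<lambda>x y. F x y + G x y) = t F + t G"
proof -
  obtain ps where ps: "\<And>F. bilinear_on UNIV (hscale V) (*) F \<Longrightarrow> t F = (\<Sum>(x, y)\<leftarrow>ps. F x y)"
    using assms(1) by (rule tensor_square_apply) blast
  have "bilinear_on UNIV (hscale V) (*) (\<lambda>x y. F x y + G x y)"
    using assms(2,3) by (auto simp: bilinear_on_def linear_on_def algebra_simps)
  then show ?thesis using assms(2,3) by (simp add: ps case_prod_unfold sum_list_addf)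
qed

lemma tensor_apply_scale:
  assumes "t \<in> tensor_square V" "bilinear_on UNIV (hscale V) (*) F"
  shows "t (\<lambda>x y. c * F x y) = c * t F"
proof -
  obtain ps where ps: "\<And>F. bilinear_on UNIV (hscale V) (*) F \<Longrightarrow> t F = (\<Sum>(x, y)\<leftarrow>ps. F x y)"
    using assms(1) by (rule tensor_square_apply) blast
  have "bilinear_on UNIV (hscale V) (*) (\<lambda>x y. c * F x y)"
    using assms(2) by (auto simp: bilinear_on_def linear_on_def algebra_simps)
  then show ?thesis using assms(2) by (simp add: ps case_prod_unfold sum_list_const_mult)
qed

lemma tensor_apply_0: "t \<in> tensor_square V \<Longrightarrow> t (\<lambda>x y. 0) = 0"
  using tensor_apply_scale[of t V "\<lambda>x y. 0" 0] by (simp add: bilinear_on_def linear_on_def)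

lemma sum_list_case_swap:
  fixes F :: "_ \<Rightarrow> _ \<Rightarrow> 'k::comm_monoid_add"
  shows "(\<Sum>p\<leftarrow>ps. \<Sum>q\<leftarrow>qs. F p q) = (\<Sum>q\<leftarrow>qs. \<Sum>p\<leftarrow>ps. F p q)"
  by (induction ps) (auto simp: sum_list_addf)

text \<open>Both tensors are finite sums, so two finite sums are exchanged. This permits reordering
  Sweedler sums of independent elements.\<close>

lemma tensor_apply_swap:
  assumes t: "t \<in> tensor_square V" "t' \<in> tensor_square W"
    and 1: "\<And>x y. bilinear_on UNIV (hscale W) (*) (F x y)"
    and 2: "\<And>u v. bilinear_on UNIV (hscale V) (*) (\<lambda>x y. F x y u v)"
  shows "t (\<lambda>x y. t' (\<lambda>u v. F x y u v)) = t' (\<lambda>u v. t (\<lambda>x y. F x y u v))"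
proof -
  obtain ps where ps: "\<And>F. bilinear_on UNIV (hscale V) (*) F \<Longrightarrow> t F = (\<Sum>(x, y)\<leftarrow>ps. F x y)"
    using t(1) by (rule tensor_square_apply) blast
  obtain qs where qs: "\<And>F. bilinear_on UNIV (hscale W) (*) F \<Longrightarrow> t' F = (\<Sum>(x, y)\<leftarrow>qs. F x y)"
    using t(2) by (rule tensor_square_apply) blast
  have 3: "t' (\<lambda>u v. F x y u v) = (\<Sum>(u, v)\<leftarrow>qs. F x y u v)" for x y by (rule qs[OF 1])
  have 4: "t (\<lambda>x y. F x y u v) = (\<Sum>(x, y)\<leftarrow>ps. F x y u v)" for u v by (rule ps[OF 2])
  have 5: "bilinear_on UNIV (hscale V) (*) (\<lambda>x y. \<Sum>(u, v)\<leftarrow>qs. F x y u v)"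
    using 2 by (induction qs) (auto simp: bilinear_on_def linear_on_def algebra_simps)
  have 6: "bilinear_on UNIV (hscale W) (*) (\<lambda>u v. \<Sum>(x, y)\<leftarrow>ps. F x y u v)"
    using 1 by (induction ps) (auto simp: bilinear_on_def linear_on_def algebra_simps)
  show ?thesis
    unfolding 3 4 ps[OF 5] qs[OF 6] by (simp add: case_prod_unfold sum_list_case_swap[of _ qs])
qed

text \<open>The list \<open>bs\<close> pairs vectors with coordinate functionals. Only the
  expansions of the two arguments are assumed, so vectors of a carrier subspace are covered as
  well.\<close>

lemma bilinear_expand:
  assumes s: "vector_space s" and G: "bilinear_on UNIV s (*) G"
    and x: "x = (\<Sum>(w, \<phi>)\<leftarrow>bs. s (\<phi> x) w)" and y: "y = (\<Sum>(w, \<phi>)\<leftarrow>bs. s (\<phi> y) w)"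
  shows "G x y = (\<Sum>(w, \<phi>)\<leftarrow>bs. \<Sum>(w', \<psi>)\<leftarrow>bs. G w w' * (\<phi> x * \<psi> y))"
proof -
  have G1: "linear_on UNIV s (*) (\<lambda>x. G x y)"
    and G2: "linear_on UNIV s (*) (G x)" for x y
    using G by (simp_all add: bilinear_on_UNIV)
  have "G x y = G (\<Sum>(w, \<phi>)\<leftarrow>bs. s (\<phi> x) w) y"
    using x by simp
  also have "\<dots> = (\<Sum>(w, \<phi>)\<leftarrow>bs. \<phi> x * G w y)"
    using linear_on_sum_list[OF G1[of y] s vector_space_mult, of "\<lambda>(w, \<phi>). s (\<phi> x) w" bs] G1
    by (simp add: case_prod_unfold linear_on_def)
  also have "\<dots> = (\<Sum>(w, \<phi>)\<leftarrow>bs. \<phi> x * G w (\<Sum>(w', \<psi>)\<leftarrow>bs. s (\<psi> y) w'))"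
    using y by simp
  also have "\<dots> = (\<Sum>(w, \<phi>)\<leftarrow>bs. \<phi> x * (\<Sum>(w', \<psi>)\<leftarrow>bs. \<psi> y * G w w'))"
    using linear_on_sum_list[OF G2 s vector_space_mult, of _ "\<lambda>(w, \<phi>). s (\<phi> y) w" bs] G2
    by (simp add: case_prod_unfold linear_on_def)
  finally show ?thesis
    by (simp add: case_prod_unfold sum_list_const_mult[symmetric] ac_simps)
qed

text \<open>Expanding both legs in coordinates writes every evaluation as a combination of
  evaluations on products of coordinate functionals. The expansion is required on the carrier only,
  since the dual space is a subspace of a function type.\<close>

lemma tensor_eqI:
  assumes V: "vec_space V" and t: "t \<in> tensor_square V" "t' \<in> tensor_square V"
    and basis: "\<And>v. v \<in> hspace V \<Longrightarrow> v = (\<Sum>(w, \<phi>)\<leftarrow>bs. hscale V (\<phi> v) w)"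
    and lin: "\<forall>p\<in>set bs. linear_on UNIV (hscale V) (*) (snd p)"
    and eq: "\<And>w \<phi> w' \<psi>. (w, \<phi>) \<in> set bs \<Longrightarrow> (w', \<psi>) \<in> set bs \<Longrightarrow>
      t (\<lambda>x y. \<phi> x * \<psi> y) = t' (\<lambda>x y. \<phi> x * \<psi> y)"
  shows "t = t'"
proof -
  have lin': "linear_on UNIV (hscale V) (*) \<phi>" if "(w, \<phi>) \<in> set bs" for w \<phi>
    using lin that by force
  have expand: "t G = (\<Sum>(w, \<phi>)\<leftarrow>bs. \<Sum>(w', \<psi>)\<leftarrow>bs. G w w' * t (\<lambda>x y. \<phi> x * \<psi> y))"
    if t: "t \<in> tensor_square V" and G: "bilinear_on UNIV (hscale V) (*) G" for t G
  proof -
    obtain ps where sub: "set ps \<subseteq> hspace V \<times> hspace V"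
      and ps: "\<And>F. bilinear_on UNIV (hscale V) (*) F \<Longrightarrow> t F = (\<Sum>(x, y)\<leftarrow>ps. F x y)"
      using t by (rule tensor_square_apply) blast
    have vs: "vector_space (hscale V)" using V by (simp add: vec_space_def)
    note * = bilinear_expand[OF vs G basis basis]
    have "t G = (\<Sum>(x, y)\<leftarrow>ps. \<Sum>(w, \<phi>)\<leftarrow>bs. \<Sum>(w', \<psi>)\<leftarrow>bs. G w w' * (\<phi> x * \<psi> y))"
      unfolding ps[OF G] using sub * by (intro arg_cong[where f = sum_list] map_cong) auto
    also have "\<dots> = (\<Sum>(w, \<phi>)\<leftarrow>bs. \<Sum>(w', \<psi>)\<leftarrow>bs. G w w' * (\<Sum>(x, y)\<leftarrow>ps. \<phi> x * \<psi> y))"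
      by (simp add: case_prod_unfold sum_list_const_mult[symmetric] sum_list_case_swap[of _ bs ps])
    also have "\<dots> = (\<Sum>(w, \<phi>)\<leftarrow>bs. \<Sum>(w', \<psi>)\<leftarrow>bs. G w w' * t (\<lambda>x y. \<phi> x * \<psi> y))"
      using lin' by (intro arg_cong[where f = sum_list] map_cong refl)
        (auto intro!: arg_cong[where f = sum_list] simp: ps bilinear_on_times)
    finally show ?thesis .
  qed
  show ?thesis
    unfolding tensor_eq_iff[OF t]
    using expand[OF t(1)] expand[OF t(2)] eq
    by (auto intro!: arg_cong[where f = sum_list])
qed

section \<open>Transport along bijections and change of structure records\<close>

lemma inv_linear_on:
  assumes "linear_on UNIV s s' f" "bij f"
  shows "linear_on UNIV s' s (inv f)"
  unfolding linear_on_def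
proof (intro conjI ballI allI)
  fix x y c
  show "inv f (x + y) = inv f x + inv f y"
    using assms unfolding linear_on_def
    by (metis UNIV_I bij_inv_eq_iff)
  show "inv f (s' c x) = s c (inv f x)"
    using assms unfolding linear_on_def
    by (metis UNIV_I bij_inv_eq_iff)
qed

text \<open>The product clauses correspond by substituting \<open>f\<close> or \<open>inv f\<close>
  for the arguments. The coproduct clauses correspond by evaluating on a bilinear form and pulling
  it back along \<open>f\<close> or \<open>inv f\<close>.\<close>

lemma hopf_transport_iff_hopf_iso:
  assumes A: "vec_space A" "hspace A = UNIV" "\<And>x. hcomult A x \<in> tensor_square A"
    and B: "vec_space B" "hspace B = UNIV" "\<And>x. hcomult B x \<in> tensor_square B"
  shows "hopf_transport A B f \<longleftrightarrow> hopf_iso A B f"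
proof (cases "bij f \<and> linear_on UNIV (hscale A) (hscale B) f")
  case True
  then have f: "bij f" "linear_on UNIV (hscale A) (hscale B) f" by auto
  note f' = inv_linear_on[OF f(2,1)]
  have fin: "f ` hspace A \<subseteq> hspace B" "inv f ` hspace B \<subseteq> hspace A" using A B by auto
  have [simp]: "f (inv f y) = y" "inv f (f x) = x" for x y
    using f(1) by (simp_all add: bij_is_surj surj_f_inv_f bij_is_inj)
  have comult: "hcomult A h = tensor_map B A (inv f) (hcomult B (f h)) \<longleftrightarrow>
      hcomult B (f h) = tensor_map A B f (hcomult A h)" for h
  proof
    assume *: "hcomult A h = tensor_map B A (inv f) (hcomult B (f h))"
    show "hcomult B (f h) = tensor_map A B f (hcomult A h)"
      unfolding tensor_eq_iff[OF B(3) tensor_map_in[OF A(1,3) f(2) fin(1)]]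
    proof (intro allI impI)
      fix F assume F: "bilinear_on UNIV (hscale B) (*) F"
      show "hcomult B (f h) F = tensor_map A B f (hcomult A h) F"
        unfolding tensor_map_apply[OF A(1,3) f(2) F]
        by (subst *, subst tensor_map_apply[OF B(1,3) f'])
          (auto intro: bilinear_on_compose[OF F f(2) f(2)])
    qed
  next
    assume *: "hcomult B (f h) = tensor_map A B f (hcomult A h)"
    show "hcomult A h = tensor_map B A (inv f) (hcomult B (f h))"
      unfolding tensor_eq_iff[OF A(3) tensor_map_in[OF B(1,3) f' fin(2)]]
    proof (intro allI impI)
      fix F assume F: "bilinear_on UNIV (hscale A) (*) F"
      show "hcomult A h F = tensor_map B A (inv f) (hcomult B (f h)) F"
        unfolding tensor_map_apply[OF B(1,3) f' F]
        by (subst *, subst tensor_map_apply[OF A(1,3) f(2)])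
          (auto intro: bilinear_on_compose[OF F f' f'])
    qed
  qed
  have mult: "(\<forall>x y. hmult B x y = f (hmult A (inv f x) (inv f y))) \<longleftrightarrow>
      (\<forall>x y. f (hmult A x y) = hmult B (f x) (f y))"
    by (metis \<open>\<And>x. inv f (f x) = x\<close> \<open>\<And>y. f (inv f y) = y\<close>)
  show ?thesis
    unfolding hopf_transport_def hopf_iso_def A(2) B(2)
    using f comult mult by auto
next
  case False
  then show ?thesis
    unfolding hopf_transport_def hopf_iso_def A(2) B(2) by auto
qed

lemma tens_eq: "hscale V = hscale W \<Longrightarrow> tens V = tens W"
  by (intro ext) (simp add: tens_def)

text \<open>Tensors depend on the carrier and the scalar multiplication alone, so passing to
  opposites or to a record with other structure maps leaves them unchanged.\<close>

lemma
  assumes "hspace V = hspace W" "hscale V = hscale W"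
  shows tensor_square_eq: "tensor_square V = tensor_square W"
    and tensor_map_eq_cod: "tensor_map U V = tensor_map U W"
    and tensor_flip_eq: "tensor_flip V = tensor_flip W"
    and vec_space_eq: "vec_space V = vec_space W"
  using assms tens_eq[OF assms(2)]
  by (auto intro!: ext simp: tensor_square_def sweedler_def tensor_map_def tensor_flip_def
      vec_space_def)

lemma op_mult_simps [simp]:
  "hspace (op_mult A) = hspace A" "hscale (op_mult A) = hscale A"
  "hmult (op_mult A) x y = hmult A y x" "hunit (op_mult A) = hunit A"
  "hcomult (op_mult A) = hcomult A" "hcounit (op_mult A) = hcounit A"
  by (simp_all add: op_mult_def)

lemma op_comult_simps [simp]:
  "hspace (op_comult A) = hspace A" "hscale (op_comult A) = hscale A"
  "hmult (op_comult A) = hmult A" "hunit (op_comult A) = hunit A"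
  "hcomult (op_comult A) x = tensor_flip A (hcomult A x)" "hcounit (op_comult A) = hcounit A"
  by (simp_all add: op_comult_def)

lemma vec_space_dual: "vec_space (dual_space V)"
  for V :: "('k::field, 'v::ab_group_add, 'z) vec_scheme"
proof -
  interpret v: vector_space "fun_scale :: 'k \<Rightarrow> ('v \<Rightarrow> 'k) \<Rightarrow> _" by (rule vector_space_fun_scale)
  show ?thesis
    unfolding vec_space_def dual_space_def
    using vector_space_fun_scale[where 'a = 'v and 'k = 'k]
    by (auto simp: v.subspace_def linear_on_def algebra_simps)
qed

section \<open>Metrics and the dual space\<close>

text \<open>The snake identity \<open>v = g\<^sup>1 (g\<^sup>2, v)\<close> is a dual basis
  expansion: the vectors are the first legs of the metric, the coordinate functionals are
  \<open>B y\<close> for the second legs \<open>y\<close>. This is where finite-dimensionality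
  enters.\<close>

lemma metric_of_basis:
  assumes V: "vec_space V" "hspace V = UNIV"
    and B: "bilinear_on UNIV (hscale V) (*) B" and g: "metric_of V B g"
  obtains bs where "\<And>v. v = (\<Sum>(w, \<phi>)\<leftarrow>bs. hscale V (\<phi> v) w)"
    "\<And>w \<phi>. (w, \<phi>) \<in> set bs \<Longrightarrow> \<exists>y. \<phi> = B y"
    "\<forall>p\<in>set bs. linear_on UNIV (hscale V) (*) (snd p)"
proof -
  interpret v: vector_space "hscale V" using V(1) by (simp add: vec_space_def)
  have "g \<in> tensor_square V" using g by (simp add: metric_of_def)
  then obtain ps where ps: "set ps \<subseteq> hspace V \<times> hspace V" "g = (\<Sum>(x, y)\<leftarrow>ps. tens V x y)"
    by (rule tensor_squareE)
  have bil: "bilinear_on (hspace V) (hscale V) (hscale V) (\<lambda>x y. hscale V (B y a) x)" for a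
    using B by (auto simp: bilinear_on_def linear_on_def v.scale_left_distrib v.scale_right_distrib
        mult.commute)
  have "v = (\<Sum>(x, y)\<leftarrow>ps. hscale V (B y v) x)" for v
    using g V(2) sweedler_sum_list[OF V(1) v.vector_space_axioms bil ps(1)]
    by (simp add: metric_of_def ps(2))
  then show ?thesis
    using B by (intro that[of "map (\<lambda>(x, y). (x, B y)) ps"])
      (auto simp: case_prod_unfold comp_def bilinear_on_UNIV)
qed

text \<open>The two snake identities with a functional applied to both sides, the form in which
  metrics are contracted later.\<close>

lemma
  assumes V: "vec_space V" "hspace V = UNIV"
    and B: "bilinear_on UNIV (hscale V) (*) B" and g: "metric_of V B g"
    and f: "linear_on UNIV (hscale V) (*) f"
  shows metric_of_apply_left: "g (\<lambda>x y. B a x * f y) = f a"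
    and metric_of_apply_right: "g (\<lambda>x y. f x * B y a) = f a"
proof -
  interpret v: vector_space "hscale V" using V(1) by (simp add: vec_space_def)
  have bil: "bilinear_on UNIV (hscale V) (hscale V) (\<lambda>x y. hscale V (B y a) x)"
    "bilinear_on UNIV (hscale V) (hscale V) (\<lambda>x y. hscale V (B a x) y)"
    using B by (auto simp: bilinear_on_def linear_on_def v.scale_left_distrib v.scale_right_distrib
        mult.commute)
  have g': "g \<in> tensor_square V" "sweedler V g (\<lambda>x y. hscale V (B a x) y) = a"
      "sweedler V g (\<lambda>x y. hscale V (B y a) x) = a"
    using g V(2) by (auto simp: metric_of_def)
  show "g (\<lambda>x y. B a x * f y) = f a" "g (\<lambda>x y. f x * B y a) = f a"
    using linear_sweedler[OF V(1) g'(1) v.vector_space_axioms bil(2) f]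
      linear_sweedler[OF V(1) g'(1) v.vector_space_axioms bil(1) f] f g'(2,3)
    by (simp_all add: linear_on_def mult.commute)
qed

text \<open>Exchanging the legs of the metric exchanges the two snake identities.\<close>

lemma nondegenerate_flip:
  assumes V: "vec_space V" "hspace V = UNIV"
    and B: "bilinear_on UNIV (hscale V) (*) B" and nd: "nondegenerate V B"
  shows "nondegenerate V (\<lambda>x y. B y x)"
proof -
  interpret v: vector_space "hscale V" using V(1) by (simp add: vec_space_def)
  obtain g where g: "metric_of V B g" using nd by (auto simp: nondegenerate_def)
  then have "g \<in> tensor_square V" by (simp add: metric_of_def)
  then obtain ps where ps: "set ps \<subseteq> hspace V \<times> hspace V" "g = (\<Sum>(x, y)\<leftarrow>ps. tens V x y)"
    by (rule tensor_squareE)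
  let ?qs = "map (\<lambda>(x, y). (y, x)) ps"
  have qs: "set ?qs \<subseteq> hspace V \<times> hspace V" by (simp add: V(2))
  have bil: "bilinear_on (hspace V) (hscale V) (hscale V) (\<lambda>x y. hscale V (B y a) x)"
    "bilinear_on (hspace V) (hscale V) (hscale V) (\<lambda>x y. hscale V (B a x) y)"
    "bilinear_on (hspace V) (hscale V) (hscale V) (\<lambda>x y. hscale V (B a y) x)"
    "bilinear_on (hspace V) (hscale V) (hscale V) (\<lambda>x y. hscale V (B x a) y)" for a
    using B by (auto simp: bilinear_on_def linear_on_def v.scale_left_distrib v.scale_right_distrib
        mult.commute)
  note sum_ps = sweedler_sum_list[OF V(1) v.vector_space_axioms _ ps(1)]
  note sum_qs = sweedler_sum_list[OF V(1) v.vector_space_axioms _ qs]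
  have eq: "(\<Sum>(x, y)\<leftarrow>ps. hscale V (B a x) y) = a" "(\<Sum>(x, y)\<leftarrow>ps. hscale V (B y a) x) = a" for a
    using g sum_ps[OF bil(1)] sum_ps[OF bil(2)] by (simp_all add: metric_of_def ps(2) V(2))
  have "metric_of V (\<lambda>x y. B y x) (\<Sum>(x, y)\<leftarrow>?qs. tens V x y)"
    unfolding metric_of_def sum_qs[OF bil(3)] sum_qs[OF bil(4)]
  proof (intro conjI ballI)
    show "(\<Sum>(x, y)\<leftarrow>?qs. tens V x y) \<in> tensor_square V"
      unfolding tensor_square_def using qs by blast
  qed (use eq in \<open>simp_all add: case_prod_unfold comp_def\<close>)
  then show ?thesis by (auto simp: nondegenerate_def)
qed

lemma hspace_dual_UNIV:
  "hspace V = UNIV \<Longrightarrow> hspace (dual_space V) = {\<phi>. linear_on UNIV (hscale V) (*) \<phi>}"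
  by (simp add: dual_space_def)

text \<open>The left snake identity recovers \<open>x\<close> from \<open>B x\<close>, which gives
  injectivity; the right one verifies an explicit preimage of each functional.\<close>

lemma nondegenerate_bij:
  assumes V: "vec_space V" "hspace V = UNIV"
    and B: "bilinear_on UNIV (hscale V) (*) B" and nd: "nondegenerate V B"
  shows "bij_betw B UNIV (hspace (dual_space V))"
proof -
  interpret v: vector_space "hscale V" using V(1) by (simp add: vec_space_def)
  obtain g where g: "metric_of V B g" using nd by (auto simp: nondegenerate_def)
  then have t: "g \<in> tensor_square V" by (simp add: metric_of_def)
  show ?thesis
    unfolding bij_betw_def
  proof (intro conjI)
    show "inj B"
    proof (rule injI)
      fix x y assume "B x = B y"
      then show "x = y" using g V(2) unfolding metric_of_def by (metis UNIV_I)
    qed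
    show "B ` UNIV = hspace (dual_space V)"
    proof (intro equalityI subsetI)
      fix \<phi> assume "\<phi> \<in> B ` UNIV"
      then show "\<phi> \<in> hspace (dual_space V)"
        using B V(2) by (auto simp: hspace_dual_UNIV bilinear_on_UNIV)
    next
      fix \<phi> assume "\<phi> \<in> hspace (dual_space V)"
      then have \<phi>: "linear_on UNIV (hscale V) (*) \<phi>" by (simp add: hspace_dual_UNIV V(2))
      \<comment> \<open>The preimage is \<open>\<phi>(g\<^sup>1) g\<^sup>2\<close>, whose pairing
        with \<open>z\<close> the metric contracts to \<open>\<phi> z\<close>.\<close>
      let ?a = "sweedler V g (\<lambda>x y. hscale V (\<phi> x) y)"
      have bil: "bilinear_on UNIV (hscale V) (hscale V) (\<lambda>x y. hscale V (\<phi> x) y)"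
        using \<phi> by (auto simp: bilinear_on_def linear_on_def v.scale_left_distrib
            v.scale_right_distrib mult.commute)
      have "B ?a z = \<phi> z" for z
      proof -
        have lin: "linear_on UNIV (hscale V) (*) (\<lambda>x. B x z)"
          using B by (simp add: bilinear_on_UNIV)
        then have "B ?a z = g (\<lambda>x y. \<phi> x * B y z)"
          using linear_sweedler[OF V(1) t v.vector_space_axioms bil lin]
          by (simp add: linear_on_def)
        then show ?thesis by (simp add: metric_of_apply_right[OF V B g \<phi>])
      qed
      then have "B ?a = \<phi>" by (rule ext)
      then show "\<phi> \<in> B ` UNIV" by (metis rangeI)
    qed
  qed
qed

lemma bij_nondegenerate:
  assumes V: "vec_space V" "hspace V = UNIV"
    and B: "bilinear_on UNIV (hscale V) (*) B"
    and basis: "\<And>v. v = (\<Sum>(w, \<phi>)\<leftarrow>bs. hscale V (\<phi> v) w)"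
    and lin: "\<forall>p\<in>set bs. linear_on UNIV (hscale V) (*) (snd p)"
    and bij: "bij_betw B UNIV (hspace (dual_space V))"
  shows "nondegenerate V B"
proof -
  interpret v: vector_space "hscale V" using V(1) by (simp add: vec_space_def)
  let ?i = "inv B"
  have B_inv: "B (?i \<phi>) = \<phi>" if "linear_on UNIV (hscale V) (*) \<phi>" for \<phi>
    using bij that by (intro f_inv_into_f) (auto simp: bij_betw_def hspace_dual_UNIV V(2))
  \<comment> \<open>The candidate metric pairs each basis vector with the element that represents
    its coordinate functional. The right snake identity is then the basis expansion itself, and the
    left one follows by applying the injective \<open>B\<close>.\<close>
  let ?ps = "map (\<lambda>(w, \<phi>). (w, ?i \<phi>)) bs"
  have ps: "set ?ps \<subseteq> hspace V \<times> hspace V" by (simp add: V(2))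
  have bil: "bilinear_on (hspace V) (hscale V) (hscale V) (\<lambda>x y. hscale V (B y a) x)"
    "bilinear_on (hspace V) (hscale V) (hscale V) (\<lambda>x y. hscale V (B a x) y)" for a
    using B by (auto simp: bilinear_on_def linear_on_def v.scale_left_distrib v.scale_right_distrib
        mult.commute)
  note sum_ps = sweedler_sum_list[OF V(1) v.vector_space_axioms _ ps]
  have left: "(\<Sum>(x, y)\<leftarrow>?ps. hscale V (B a x) y) = a" (is "?l = a") for a
  proof -
    have "B ?l z = B a z" for z
    proof -
      have l1: "linear_on UNIV (hscale V) (*) (\<lambda>x. B x z)"
        and l2: "linear_on UNIV (hscale V) (*) (B a)"
        using B by (simp_all add: bilinear_on_UNIV)
      have "B ?l z = (\<Sum>(w, \<phi>)\<leftarrow>bs. B a w * B (?i \<phi>) z)"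
        using l1 linear_on_sum_list[OF l1 v.vector_space_axioms vector_space_mult,
            of "\<lambda>(x, y). hscale V (B a x) y" ?ps]
        by (simp add: case_prod_unfold comp_def linear_on_def)
      also have "\<dots> = (\<Sum>(w, \<phi>)\<leftarrow>bs. B a w * \<phi> z)"
        using lin B_inv by (intro arg_cong[where f = sum_list] map_cong) force+
      also have "\<dots> = B a (\<Sum>(w, \<phi>)\<leftarrow>bs. hscale V (\<phi> z) w)"
        using l2 linear_on_sum_list[OF l2 v.vector_space_axioms vector_space_mult,
            of "\<lambda>(w, \<phi>). hscale V (\<phi> z) w" bs]
        by (simp add: case_prod_unfold comp_def linear_on_def mult.commute)
      finally show ?thesis using basis[of z] by simp
    qed
    then have "B ?l = B a" by (rule ext)
    then show ?thesis using bij by (auto simp: bij_betw_def dest: injD)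
  qed
  have right: "(\<Sum>(x, y)\<leftarrow>?ps. hscale V (B y a) x) = a" for a
  proof -
    have "(\<Sum>(x, y)\<leftarrow>?ps. hscale V (B y a) x) = (\<Sum>(w, \<phi>)\<leftarrow>bs. hscale V (B (?i \<phi>) a) w)"
      by (simp add: case_prod_unfold comp_def)
    also have "\<dots> = (\<Sum>(w, \<phi>)\<leftarrow>bs. hscale V (\<phi> a) w)"
      using lin B_inv by (intro arg_cong[where f = sum_list] map_cong) force+
    finally show ?thesis using basis[of a] by simp
  qed
  have "metric_of V B (\<Sum>(x, y)\<leftarrow>?ps. tens V x y)"
    unfolding metric_of_def sum_ps[OF bil(1)] sum_ps[OF bil(2)] left right
    using ps unfolding tensor_square_def by blast
  then show ?thesis by (auto simp: nondegenerate_def)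
qed

text \<open>The coproduct of \<open>dual_hopf\<close> is a definite description. The dual basis
  yields both existence and uniqueness, after which the coproduct is handled only through its values
  on pairs of evaluations.\<close>

lemma
  fixes V :: "('k::field, 'v::ab_group_add) hopf_data"
  assumes V: "vec_space V" "hspace V = UNIV"
    and basis: "\<And>v. v = (\<Sum>(w, \<phi>)\<leftarrow>bs. hscale V (\<phi> v) w)"
    and lin: "\<forall>p\<in>set bs. linear_on UNIV (hscale V) (*) (snd p)"
    and mult: "bilinear_on UNIV (hscale V) (hscale V) (hmult V)"
    and f: "linear_on UNIV (hscale V) (*) f"
  shows dual_comult_in: "hcomult (dual_hopf V) f \<in> tensor_square (dual_space V)"
    and dual_comult_eq_iff: "t \<in> tensor_square (dual_space V) \<Longrightarrow>
      hcomult (dual_hopf V) f = t \<longleftrightarrow> (\<forall>x y. t (\<lambda>\<alpha> \<beta>. \<alpha> x * \<beta> y) = f (hmult V x y))"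
proof -
  interpret v: vector_space "hscale V" using V(1) by (simp add: vec_space_def)
  define P where "P t \<longleftrightarrow> t \<in> tensor_square (dual_space V) \<and>
    (\<forall>x\<in>hspace V. \<forall>y\<in>hspace V. sweedler (dual_space V) t (\<lambda>\<alpha> \<beta>. \<alpha> x * \<beta> y) = f (hmult V x y))"
    for t
  have scale: "hscale (dual_space V) = fun_scale" by (simp add: dual_space_def)
  have bil: "bilinear_on UNIV (hscale (dual_space V)) (*) (\<lambda>\<alpha> \<beta>. \<alpha> x * \<beta> y)" for x y
    unfolding scale by (rule bilinear_on_times[OF linear_on_apply linear_on_apply])
  have P_iff: "P t \<longleftrightarrow> t \<in> tensor_square (dual_space V) \<and>
      (\<forall>x y. t (\<lambda>\<alpha> \<beta>. \<alpha> x * \<beta> y) = f (hmult V x y))" for t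
    unfolding P_def V(2) using sweedler_scalar[OF vec_space_dual _ bil, of t] by auto
  have uniq: "t = t'" if "P t" "P t'" for t t'
  proof (rule tensor_eqI[OF vec_space_dual])
    fix \<alpha> assume "\<alpha> \<in> hspace (dual_space V)"
    then have \<alpha>: "linear_on UNIV (hscale V) (*) \<alpha>" by (simp add: hspace_dual_UNIV V(2))
    \<comment> \<open>The dual basis with its roles exchanged: in the dual space the vector is
      \<open>\<phi>\<close> and its coordinate is evaluation at \<open>w\<close>. Agreement on
      products of evaluations therefore forces equality.\<close>
    show "\<alpha> = (\<Sum>(w, \<phi>)\<leftarrow>map (\<lambda>(w, \<phi>). (\<phi>, \<lambda>\<alpha>. \<alpha> w)) bs. hscale (dual_space V) (\<phi> \<alpha>) w)"
    proof
      fix z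
      have "\<alpha> z = \<alpha> (\<Sum>(w, \<phi>)\<leftarrow>bs. hscale V (\<phi> z) w)" using basis[of z] by simp
      also have "\<dots> = (\<Sum>(w, \<phi>)\<leftarrow>bs. \<phi> z * \<alpha> w)"
        using \<alpha> linear_on_sum_list[OF \<alpha> v.vector_space_axioms vector_space_mult,
            of "\<lambda>(w, \<phi>). hscale V (\<phi> z) w" bs]
        by (simp add: case_prod_unfold comp_def linear_on_def mult.commute)
      also have "\<dots> = (\<Sum>(w, \<phi>)\<leftarrow>bs. fun_scale (\<alpha> w) \<phi>) z"
        using linear_on_sum_list[OF linear_on_apply[of z] vector_space_fun_scale vector_space_mult,
            of "\<lambda>(w, \<phi>). fun_scale (\<alpha> w) \<phi>" bs]
        by (simp add: case_prod_unfold comp_def mult.commute)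
      finally show "\<alpha> z = (\<Sum>(w, \<phi>)\<leftarrow>map (\<lambda>(w, \<phi>). (\<phi>, \<lambda>\<alpha>. \<alpha> w)) bs.
          hscale (dual_space V) (\<phi> \<alpha>) w) z"
        by (simp add: scale case_prod_unfold comp_def)
    qed
  next
    show "\<forall>p\<in>set (map (\<lambda>(w, \<phi>). (\<phi>, \<lambda>\<alpha>. \<alpha> w)) bs).
        linear_on UNIV (hscale (dual_space V)) (*) (snd p)"
      by (auto simp: scale linear_on_apply)
  qed (use that in \<open>auto simp: P_iff\<close>)
  \<comment> \<open>Existence: the tensor with coefficients \<open>f (hmult V w w')\<close> at
    \<open>\<phi> \<otimes> \<phi>'\<close>, which are the coordinates of the bilinear form
    \<open>f (hmult V x y)\<close>.\<close>
  let ?qs = "map (\<lambda>((w, \<phi>), (w', \<phi>')). (fun_scale (f (hmult V w w')) \<phi>, \<phi>')) (List.product bs bs)"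
  have qs: "set ?qs \<subseteq> hspace (dual_space V) \<times> hspace (dual_space V)"
  proof -
    have "linear_on UNIV (hscale V) (*) (fun_scale c \<phi>)" if "(w, \<phi>) \<in> set bs" for c w \<phi>
      using lin that by (force simp: linear_on_def algebra_simps)
    then show ?thesis using lin by (fastforce simp: hspace_dual_UNIV V(2))
  qed
  have ex: "P (\<Sum>(\<alpha>, \<beta>)\<leftarrow>?qs. tens (dual_space V) \<alpha> \<beta>)"
    unfolding P_iff sum_tens_apply[OF bil]
  proof (intro conjI allI)
    show "(\<Sum>(\<alpha>, \<beta>)\<leftarrow>?qs. tens (dual_space V) \<alpha> \<beta>) \<in> tensor_square (dual_space V)"
      unfolding tensor_square_def using qs by blast
    fix x y
    have "bilinear_on UNIV (hscale V) (*) (\<lambda>x y. f (hmult V x y))"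
      using mult f by (auto simp: bilinear_on_def linear_on_def)
    note exp = bilinear_expand[OF v.vector_space_axioms this basis[of x] basis[of y]]
    have prod: "(\<Sum>(p, q)\<leftarrow>List.product as cs. G p q) = (\<Sum>p\<leftarrow>as. \<Sum>q\<leftarrow>cs. G p q)"
      for as cs :: "('v \<times> ('v \<Rightarrow> 'k)) list" and G :: "_ \<Rightarrow> _ \<Rightarrow> 'k"
      by (induction as) (auto simp: comp_def)
    show "(\<Sum>(\<alpha>, \<beta>)\<leftarrow>?qs. \<alpha> x * \<beta> y) = f (hmult V x y)"
      unfolding exp using prod[where G = "\<lambda>(w, \<phi>) (w', \<phi>'). f (hmult V w w') * (\<phi> x * \<phi>' y)"]
      by (simp add: case_prod_unfold comp_def mult.assoc)
  qed
  have "hcomult (dual_hopf V) f = (THE t. P t)"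
    unfolding dual_hopf_def P_def by simp
  moreover have "P (THE t. P t)" by (rule theI'[of P]) (use ex uniq in blast)
  ultimately have Pd: "P (hcomult (dual_hopf V) f)" by simp
  then show "hcomult (dual_hopf V) f \<in> tensor_square (dual_space V)" by (simp add: P_iff)
  show "hcomult (dual_hopf V) f = t \<longleftrightarrow> (\<forall>x y. t (\<lambda>\<alpha> \<beta>. \<alpha> x * \<beta> y) = f (hmult V x y))"
    if "t \<in> tensor_square (dual_space V)"
  proof
    assume "hcomult (dual_hopf V) f = t"
    then show "\<forall>x y. t (\<lambda>\<alpha> \<beta>. \<alpha> x * \<beta> y) = f (hmult V x y)"
      using Pd by (simp add: P_iff)
  next
    assume "\<forall>x y. t (\<lambda>\<alpha> \<beta>. \<alpha> x * \<beta> y) = f (hmult V x y)"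
    then have "P t" using that by (simp add: P_iff)
    then show "hcomult (dual_hopf V) f = t" by (rule uniq[OF Pd])
  qed
qed

section \<open>Frobenius Hopf algebras\<close>

locale frobenius_hopf =
  fixes H :: "('k::field, 'h::ab_group_add) hopf_data"
    and S :: "'h \<Rightarrow> 'h"
    and form_r form_g :: "'h \<Rightarrow> 'h \<Rightarrow> 'k"
    and g_r g_g :: "('k, 'h) tensor"
  assumes whole: "hspace H = UNIV"
    and hopf: "hopf_algebra H S"
    and frob_r: "frobenius_algebra H form_r g_r"
    and frob_g: "frobenius_coalgebra H form_g g_g"
    and antipode: "\<And>h. S h = sweedler H g_r (\<lambda>x y. hscale H (form_g h x) y)"
begin

abbreviation mult (infixl "\<odot>" 70) where "x \<odot> y \<equiv> hmult H x y"
abbreviation "D \<equiv> hcomult H"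
abbreviation "\<epsilon> \<equiv> hcounit H"
abbreviation "u \<equiv> hunit H"
abbreviation "lin \<equiv> linear_on UNIV (hscale H) ((*) :: 'k \<Rightarrow> 'k \<Rightarrow> 'k)"
abbreviation "endo \<equiv> linear_on UNIV (hscale H) (hscale H)"
abbreviation "bil \<equiv> bilinear_on UNIV (hscale H) ((*) :: 'k \<Rightarrow> 'k \<Rightarrow> 'k)"
abbreviation "tril \<equiv> trilinear_on UNIV (hscale H) ((*) :: 'k \<Rightarrow> 'k \<Rightarrow> 'k)"

lemma bialg: "bialgebra H" and alg: "unital_algebra H" and coalg: "coalgebra H"
  using hopf by (auto simp: hopf_algebra_def bialgebra_def)

lemma vs: "vec_space H"
  using alg by (simp add: unital_algebra_def)

sublocale V: vector_space "hscale H"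
  using vs by (simp add: vec_space_def)

lemma tensors [simp]: "D h \<in> tensor_square H" "g_r \<in> tensor_square H" "g_g \<in> tensor_square H"
  using coalg frob_r frob_g
  by (auto simp: coalgebra_def frobenius_algebra_def frobenius_coalgebra_def metric_of_def whole)

lemma bil_r: "bil form_r" and bil_g: "bil form_g" and metric_r: "metric_of H form_r g_r"
  and metric_g: "metric_of H form_g g_g"
  using frob_r frob_g by (auto simp: frobenius_algebra_def frobenius_coalgebra_def whole)

lemma algebra [simp]: "x \<odot> y \<odot> z = x \<odot> (y \<odot> z)" "u \<odot> x = x" "x \<odot> u = x"
  using alg by (simp_all add: unital_algebra_def whole)

lemma bil_mult: "bilinear_on UNIV (hscale H) (hscale H) (\<odot>)"
  using alg by (simp add: unital_algebra_def whole)

section \<open>Multilinearity of Sweedler expressions\<close>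

lemma endo_id: "endo (\<lambda>x. x)"
  by (simp add: linear_on_def)

lemma endo_mult: "endo p \<Longrightarrow> endo (\<lambda>x. p x \<odot> y)" "endo p \<Longrightarrow> endo (\<lambda>x. y \<odot> p x)"
  using bil_mult by (simp_all add: bilinear_on_def linear_on_def)

lemma endo_S: "endo p \<Longrightarrow> endo (\<lambda>x. S (p x))"
  using hopf by (simp add: hopf_algebra_def linear_on_def whole)

lemma lin_comp: "lin f \<Longrightarrow> endo p \<Longrightarrow> lin (\<lambda>x. f (p x))"
  by (simp add: linear_on_def)

lemma lin_bil: "bil B \<Longrightarrow> endo p \<Longrightarrow> lin (\<lambda>x. B (p x) y)" "bil B \<Longrightarrow> endo p \<Longrightarrow> lin (\<lambda>x. B y (p x))"
  by (simp_all add: bilinear_on_def linear_on_def)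

lemma lin_counit: "lin \<epsilon>"
  using coalg by (simp add: coalgebra_def whole)

lemma lin_times: "lin f \<Longrightarrow> lin (\<lambda>x. c * f x)" "lin f \<Longrightarrow> lin (\<lambda>x. f x * c)"
  by (simp_all add: linear_on_def algebra_simps)

lemma lin_tensor:
  assumes "t \<in> tensor_square H" "\<And>x. bil (F x)" "\<And>a b. lin (\<lambda>x. F x a b)"
  shows "lin (\<lambda>x. t (F x))"
proof -
  have "F (x + y) = (\<lambda>a b. F x a b + F y a b)" for x y
    using assms(3) by (intro ext) (simp add: linear_on_def)
  then have "t (F (x + y)) = t (F x) + t (F y)" for x y
    using tensor_apply_add[OF assms(1) assms(2) assms(2), of x y] by simp
  moreover have "F (hscale H c x) = (\<lambda>a b. c * F x a b)" for c x
    using assms(3) by (intro ext) (simp add: linear_on_def)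
  then have "t (F (hscale H c x)) = c * t (F x)" for c x
    using tensor_apply_scale[OF assms(1) assms(2), of c x] by simp
  ultimately show ?thesis by (simp add: linear_on_def)
qed

lemma lin_comult: "endo p \<Longrightarrow> lin (\<lambda>x. D (p x) F)"
  using coalg by (simp add: coalgebra_def whole linear_on_def)

text \<open>A simp set that splits bilinearity into linearity in each argument and follows the
  syntax of the expression, nested evaluations included. It discharges the side conditions of the
  tensor calculus below.\<close>

lemmas multilinear = endo_id endo_mult endo_S lin_comp[OF lin_counit] lin_bil[OF bil_r]
  lin_bil[OF bil_g] lin_times lin_tensor[OF tensors(1)] lin_tensor[OF tensors(2)]
  lin_tensor[OF tensors(3)] lin_comult bilinear_on_UNIV

section \<open>The Hopf and Frobenius axioms evaluated on scalar forms\<close>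

lemma trilinear_on_UNIV_iff:
  "trilinear_on UNIV s s' T \<longleftrightarrow> (\<forall>x y. linear_on UNIV s s' (T x y)) \<and>
     (\<forall>x z. linear_on UNIV s s' (\<lambda>y. T x y z)) \<and> (\<forall>y z. linear_on UNIV s s' (\<lambda>x. T x y z))"
  by (auto simp: trilinear_on_def bilinear_on_UNIV)

lemma bil_fun_iff:
  "bilinear_on UNIV (hscale H) fun_scale F \<longleftrightarrow> (\<forall>T. bil (\<lambda>x y. F x y T))"
  by (auto simp: bilinear_on_def linear_on_def fun_eq_iff)

text \<open>Turns the nested Sweedler sums of triple tensors in the axioms into iterated
  evaluations, so that coassociativity and the Frobenius condition become scalar identities.\<close>

lemma sweedler_tens3_left:
  assumes t: "t \<in> tensor_square H" and T: "tril T"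
  shows "sweedler H t (\<lambda>x z. sweedler H (D x) (\<lambda>a b. tens3 H a b z)) T =
    t (\<lambda>x z. D x (\<lambda>a b. T a b z))"
proof -
  have bil3: "bilinear_on UNIV (hscale H) fun_scale (\<lambda>a b. tens3 H a b z)" for z
    unfolding bil_fun_iff by (auto simp: tens3_def trilinear_on_UNIV_iff bilinear_on_UNIV linear_on_def)
  have eq: "sweedler H (D x) (\<lambda>a b. tens3 H a b z) T = D x (\<lambda>a b. tens3 H a b z T)" for x z T
    by (rule sweedler_fun_apply[OF vs tensors(1) bil3])
  have "bilinear_on UNIV (hscale H) fun_scale (\<lambda>x z. sweedler H (D x) (\<lambda>a b. tens3 H a b z))"
    unfolding bil_fun_iff eq
  proof
    fix T
    show "bil (\<lambda>x z. D x (\<lambda>a b. tens3 H a b z T))"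
    \<comment> \<open>A function-valued map is bilinear when it is so at every \<open>T\<close>. At
      a \<open>T\<close> that is not trilinear, \<open>tens3\<close> takes its default 0 and the
      expression vanishes identically.\<close>
    proof (cases "tril T")
      case True
      then show ?thesis
        by (auto simp: tens3_def multilinear trilinear_on_UNIV_iff)
    next
      case False
      then show ?thesis
        by (simp add: tens3_def tensor_apply_0[OF tensors(1)] bilinear_on_def linear_on_def)
    qed
  qed
  from sweedler_fun_apply[OF vs t this] eq T show ?thesis
    by (simp add: tens3_def)
qed

lemma sweedler_tens3_right:
  assumes t: "t \<in> tensor_square H" and T: "tril T"
  shows "sweedler H t (\<lambda>x z. sweedler H (D z) (\<lambda>a b. tens3 H x a b)) T =
    t (\<lambda>x z. D z (\<lambda>a b. T x a b))"
proof -
  have bil3: "bilinear_on UNIV (hscale H) fun_scale (\<lambda>a b. tens3 H z a b)" for z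
    unfolding bil_fun_iff by (auto simp: tens3_def trilinear_on_UNIV_iff bilinear_on_UNIV linear_on_def)
  have eq: "sweedler H (D x) (\<lambda>a b. tens3 H z a b) T = D x (\<lambda>a b. tens3 H z a b T)" for x z T
    by (rule sweedler_fun_apply[OF vs tensors(1) bil3])
  have "bilinear_on UNIV (hscale H) fun_scale (\<lambda>x z. sweedler H (D z) (\<lambda>a b. tens3 H x a b))"
    unfolding bil_fun_iff eq
  proof
    fix T
    show "bil (\<lambda>x z. D z (\<lambda>a b. tens3 H x a b T))"
    proof (cases "tril T")
      case True
      then show ?thesis
        by (auto simp: tens3_def multilinear trilinear_on_UNIV_iff)
    next
      case False
      then show ?thesis
        by (simp add: tens3_def tensor_apply_0[OF tensors(1)] bilinear_on_def linear_on_def)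
    qed
  qed
  from sweedler_fun_apply[OF vs t this] eq T show ?thesis
    by (simp add: tens3_def)
qed

lemma coassoc:
  "tril T \<Longrightarrow> D h (\<lambda>x z. D x (\<lambda>a b. T a b z)) = D h (\<lambda>x z. D z (\<lambda>a b. T x a b))"
  using coalg sweedler_tens3_left[of "D h" T] sweedler_tens3_right[of "D h" T]
  by (simp add: coalgebra_def whole)

lemma frobenius_g:
  "tril T \<Longrightarrow> g_g (\<lambda>x y. D x (\<lambda>a b. T a b y)) = g_g (\<lambda>x y. D y (\<lambda>a b. T x a b))"
  using frob_g sweedler_tens3_left[of g_g T] sweedler_tens3_right[of g_g T]
  by (simp add: frobenius_coalgebra_def)

lemma bil_scale: "lin f \<Longrightarrow> bilinear_on UNIV (hscale H) (hscale H) (\<lambda>a b. hscale H (f a) b)"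
  by (auto simp: bilinear_on_def linear_on_def V.scale_left_distrib V.scale_right_distrib mult.commute)

lemma bil_endos:
  "endo p \<Longrightarrow> endo q \<Longrightarrow> bilinear_on UNIV (hscale H) (hscale H) (\<lambda>a b. p a \<odot> q b)"
  by (rule bilinear_on_compose[OF bil_mult])

lemma lin_scale: "lin f \<Longrightarrow> f (hscale H c x) = c * f x"
  by (simp add: linear_on_def)

lemma counit_left: assumes f: "lin f" shows "D h (\<lambda>a b. \<epsilon> a * f b) = f h"
  using coalg linear_sweedler[OF vs tensors(1) V.vector_space_axioms bil_scale[OF lin_counit] f, of h]
  by (simp add: coalgebra_def whole lin_scale[OF f])

lemma counit_right: assumes f: "lin f" shows "D h (\<lambda>a b. f a * \<epsilon> b) = f h"
  using coalg f linear_sweedler[OF vs tensors(1) V.vector_space_axioms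
      bilinear_on_flip[OF bil_scale[OF lin_counit]] f, of h]
  by (simp add: coalgebra_def whole lin_scale[OF f] mult.commute)

lemma antipode_left: assumes f: "lin f" shows "D h (\<lambda>a b. f (S a \<odot> b)) = \<epsilon> h * f u"
  using hopf linear_sweedler[OF vs tensors(1) V.vector_space_axioms
      bil_endos[OF endo_S[OF endo_id] endo_id] f, of h]
  by (simp add: hopf_algebra_def whole lin_scale[OF f])

lemma antipode_right: assumes f: "lin f" shows "D h (\<lambda>a b. f (a \<odot> S b)) = \<epsilon> h * f u"
  using hopf linear_sweedler[OF vs tensors(1) V.vector_space_axioms
      bil_endos[OF endo_id endo_S[OF endo_id]] f, of h]
  by (simp add: hopf_algebra_def whole lin_scale[OF f])

lemma counit_mult: "\<epsilon> (x \<odot> y) = \<epsilon> x * \<epsilon> y" and counit_unit: "\<epsilon> u = 1"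
  using bialg by (simp_all add: bialgebra_def whole)

lemma comult_unit: "bil F \<Longrightarrow> D u F = F u u"
  using bialg by (simp add: bialgebra_def tens_def)

lemma comult_mult:
  assumes F: "bil F"
  shows "D (x \<odot> y) F = D x (\<lambda>a b. D y (\<lambda>a' b'. F (a \<odot> a') (b \<odot> b')))"
proof -
  have bil1: "bilinear_on UNIV (hscale H) fun_scale (\<lambda>a' b'. tens H (a \<odot> a') (b \<odot> b'))" for a b
    by (rule bilinear_on_compose[OF bilinear_tens]) (simp_all add: multilinear)
  have eq: "sweedler H (D y) (\<lambda>a' b'. tens H (a \<odot> a') (b \<odot> b')) G =
      D y (\<lambda>a' b'. tens H (a \<odot> a') (b \<odot> b') G)" for a b G
    by (rule sweedler_fun_apply[OF vs tensors(1) bil1])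
  have "bil (\<lambda>a b. D y (\<lambda>a' b'. tens H (a \<odot> a') (b \<odot> b') G))" for G
  \<comment> \<open>The same split for \<open>tens\<close>: at a form that is not bilinear all
    values are 0.\<close>
  proof (cases "bil G")
    case True
    then show ?thesis
      by (simp add: tens_def multilinear lin_bil[OF True])
  next
    case False
    then show ?thesis
      by (simp add: tens_def tensor_apply_0[OF tensors(1)], simp add: bilinear_on_def linear_on_def)
  qed
  then have bil2: "bilinear_on UNIV (hscale H) fun_scale
      (\<lambda>a b. sweedler H (D y) (\<lambda>a' b'. tens H (a \<odot> a') (b \<odot> b')))"
    unfolding bil_fun_iff eq by blast
  have "D (x \<odot> y) = sweedler H (D x) (\<lambda>a b. sweedler H (D y) (\<lambda>a' b'. tens H (a \<odot> a') (b \<odot> b')))"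
    using bialg by (simp add: bialgebra_def whole)
  then have "D (x \<odot> y) F = D x (\<lambda>a b. D y (\<lambda>a' b'. tens H (a \<odot> a') (b \<odot> b') F))"
    by (simp only: sweedler_fun_apply[OF vs tensors(1) bil2] eq)
  then show ?thesis by (simp add: tens_apply[OF F])
qed

section \<open>Testing with the two Frobenius forms\<close>

lemma form_r_assoc: "form_r (a \<odot> b) c = form_r a (b \<odot> c)"
  using frob_r by (simp add: frobenius_algebra_def whole)

lemma form_r_eqI_right: "(\<And>a. form_r a x = form_r a y) \<Longrightarrow> x = y"
  and form_r_eqI_left: "(\<And>a. form_r x a = form_r y a) \<Longrightarrow> x = y"
  and form_g_eqI_left: "(\<And>a. form_g x a = form_g y a) \<Longrightarrow> x = y"
  using metric_r metric_g unfolding metric_of_def whole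
  by (metis (no_types, lifting) UNIV_I ext)+

text \<open>The functionals \<open>form_r a\<close> already separate points.\<close>

lemma functional_eqI:
  assumes "\<And>f. lin f \<Longrightarrow> f x = f y"
  shows "x = y"
  by (rule form_r_eqI_right) (rule assms, simp add: multilinear)

text \<open>The surjectivity half of \<open>nondegenerate_bij\<close>. Applied to
  \<open>\<epsilon>\<close> it yields the element \<open>c\<close> that encodes the antipode
  below.\<close>

lemma functional_as_form_r: assumes "lin f" obtains c where "\<And>x. form_r c x = f x"
  using nondegenerate_bij[OF vs whole bil_r] metric_r assms
  unfolding nondegenerate_def bij_betw_def hspace_dual_UNIV[OF whole] by (smt (verit) imageE mem_Collect_eq)

lemma functional_as_form_g: assumes "lin f" obtains c where "\<And>x. form_g c x = f x"
  using nondegenerate_bij[OF vs whole bil_g] metric_g assms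
  unfolding nondegenerate_def bij_betw_def hspace_dual_UNIV[OF whole] by (smt (verit) imageE mem_Collect_eq)

text \<open>A snake identity writes \<open>h'\<close> through the metric, the Frobenius condition
  moves the coproduct from its first leg to its second, and the other snake identity contracts the
  first leg with \<open>h\<close>. The result says that both expressions for the product of the
  associated Hopf algebra agree.\<close>

lemma comult_form_g:
  assumes f: "lin f"
  shows "D h (\<lambda>a b. f a * form_g b h') = D h' (\<lambda>a b. form_g h a * f b)"
proof -
  have "D h' (\<lambda>a b. form_g h a * f b) = g_g (\<lambda>x y. D x (\<lambda>a b. form_g h a * f b) * form_g y h')"
    using f by (intro metric_of_apply_right[OF vs whole bil_g metric_g, symmetric])
      (simp add: multilinear)
  also have "\<dots> = g_g (\<lambda>x y. D x (\<lambda>a b. form_g h a * f b * form_g y h'))"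
    using tensor_apply_scale[OF tensors(1), of "\<lambda>a b. form_g h a * f b"] f
    by (simp add: multilinear mult.commute)
  also have "\<dots> = g_g (\<lambda>x y. D y (\<lambda>a b. form_g h x * (f a * form_g b h')))"
    using frobenius_g[of "\<lambda>a b y. form_g h a * f b * form_g y h'"] f
    by (simp add: trilinear_on_UNIV_iff multilinear mult.assoc)
  also have "\<dots> = g_g (\<lambda>x y. form_g h x * D y (\<lambda>a b. f a * form_g b h'))"
    using f by (simp add: tensor_apply_scale[OF tensors(1)] multilinear)
  also have "\<dots> = D h (\<lambda>a b. f a * form_g b h')"
    using f by (intro metric_of_apply_left[OF vs whole bil_g metric_g]) (simp add: multilinear)
  finally show ?thesis by simp
qed

text \<open>Pairing the antipode formula with \<open>a\<close> leaves
  \<open>(h, g\<^sup>1)_g (g\<^sup>2, a)_r\<close>, which the metric of \<open>form_r\<close>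
  contracts.\<close>

lemma form_g_eq: "form_g h a = form_r (S h) a"
proof -
  have "form_r (S h) a = g_r (\<lambda>x y. form_r (hscale H (form_g h x) y) a)"
    unfolding antipode
    by (rule linear_sweedler[OF vs tensors(2) V.vector_space_axioms bil_scale])
      (simp_all add: multilinear)
  also have "\<dots> = g_r (\<lambda>x y. form_g h x * form_r y a)"
    by (subst lin_scale[of "\<lambda>y. form_r y a"]) (simp_all add: multilinear)
  also have "\<dots> = form_g h a"
    by (intro metric_of_apply_right[OF vs whole bil_r metric_r]) (simp add: multilinear)
  finally show ?thesis by simp
qed

section \<open>The integral and the antipode\<close>

lemma S_unit: "S u = u"
proof (rule functional_eqI)
  fix f assume f: "lin f"
  have "D u (\<lambda>a b. f (S a \<odot> b)) = f (S u \<odot> u)"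
    by (rule comult_unit) (simp add: multilinear lin_comp[OF f])
  then show "f (S u) = f u"
    using antipode_left[OF f, of u] by (simp add: counit_unit)
qed

lemma integral:
  assumes f: "lin f"
  shows "D x (\<lambda>a b. form_r u a * f b) = form_r u x * f u"
proof -
  have "D u (\<lambda>a b. f a * form_g b x) = f u * form_g u x"
    by (rule comult_unit) (simp add: multilinear f)
  with comult_form_g[OF f, of u x] show ?thesis
    by (simp add: form_g_eq S_unit mult.commute)
qed

text \<open>The factor \<open>x2 S(x3)\<close> is inserted behind the second leg of
  \<open>c\<close>. After regrouping, the coproduct of the product of \<open>c\<close> with the
  first part of \<open>x\<close> appears, and \<open>integral\<close> collapses it, leaving only the
  antipode of the last leg of \<open>x\<close>.\<close>

lemma form_r_antipode:
  assumes f: "lin f"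
  shows "D x (\<lambda>a b. form_r c a * f (S b)) = D c (\<lambda>a b. form_r a x * f b)"
proof -
  note lf = multilinear lin_comp[OF f]
  have "D c (\<lambda>a b. form_r a x * f b) = D c (\<lambda>a b. D x (\<lambda>x1 x'. (form_r a x1 * f b) * \<epsilon> x'))"
    by (subst counit_right) (simp_all add: lf)
  \<comment> \<open>The antipode axiom read backwards expands the counit of
    \<open>x'\<close>.\<close>
  also have "\<dots> = D c (\<lambda>a b. D x (\<lambda>x1 x'. D x' (\<lambda>x2 x3. form_r a x1 * f (b \<odot> (x2 \<odot> S x3)))))"
    by (subst antipode_right) (simp_all add: lf mult.commute)
  also have "\<dots> = D c (\<lambda>a b. D x (\<lambda>x' x3. D x' (\<lambda>x1 x2. form_r a x1 * f (b \<odot> (x2 \<odot> S x3)))))"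
    by (subst coassoc) (simp_all add: lf trilinear_on_UNIV_iff)
  also have "\<dots> = D x (\<lambda>x' x3. D c (\<lambda>a b. D x' (\<lambda>x1 x2. form_r a x1 * f (b \<odot> (x2 \<odot> S x3)))))"
    by (subst tensor_apply_swap[OF tensors(1) tensors(1)]) (simp_all add: lf)
  \<comment> \<open>Invariance of \<open>form_r\<close> moves \<open>a\<close> and \<open>x1\<close>
    into one slot, so that the integral \<open>form_r u\<close> becomes visible.\<close>
  also have "\<dots> = D x (\<lambda>x' x3. D c (\<lambda>a b. D x' (\<lambda>x1 x2.
      form_r u (a \<odot> x1) * f ((b \<odot> x2) \<odot> S x3))))"
    by (simp add: form_r_assoc[symmetric])
  also have "\<dots> = D x (\<lambda>x' x3. D (c \<odot> x') (\<lambda>p q. form_r u p * f (q \<odot> S x3)))"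
    by (subst comult_mult) (simp_all add: lf)
  also have "\<dots> = D x (\<lambda>x' x3. form_r u (c \<odot> x') * f (u \<odot> S x3))"
    by (subst integral) (simp_all add: lf)
  also have "\<dots> = D x (\<lambda>a b. form_r c a * f (S b))"
    by (simp add: form_r_assoc[symmetric])
  finally show ?thesis by simp
qed

lemma form_r_form_g:
  "D x (\<lambda>a b. form_r c a * form_g b y) = D c (\<lambda>a b. form_r a x * form_r b y)"
  unfolding form_g_eq by (rule form_r_antipode) (simp add: multilinear)

text \<open>By \<open>form_g_eq\<close>, \<open>S\<close> compares the two bijections from
  \<open>H\<close> to its dual given by \<open>form_g\<close> and \<open>form_r\<close>.\<close>

lemma bij_S: "bij S"
proof (rule bijI)
  show "inj S"
    by (rule injI) (rule form_g_eqI_left, simp add: form_g_eq)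
  show "surj S"
    unfolding surj_def
  proof
    fix y
    have "lin (form_r y)" by (simp add: multilinear)
    then obtain x where "\<And>z. form_g x z = form_r y z"
      by (rule functional_as_form_g) blast
    then have "y = S x" by (intro form_r_eqI_left) (simp add: form_g_eq)
    then show "\<exists>x. y = S x" by blast
  qed
qed

lemma counit_S: "\<epsilon> (S h) = \<epsilon> h"
proof -
  have "\<epsilon> (S h) = D h (\<lambda>a b. \<epsilon> (S a) * \<epsilon> b)"
    by (subst counit_right) (simp_all add: multilinear)
  then show ?thesis
    using antipode_left[OF lin_counit, of h] by (simp add: counit_mult counit_unit)
qed

text \<open>For this \<open>c\<close> the left side of \<open>form_r_antipode\<close> collapses by
  the counit axiom, so the single coproduct \<open>D c\<close> encodes all of
  \<open>S\<close>.\<close>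

lemma functional_S_eq:
  assumes f: "lin f" and c: "\<And>x. form_r c x = \<epsilon> x"
  shows "f (S x) = D c (\<lambda>a b. form_r a x * f b)"
  using form_r_antipode[OF f, of x c] counit_left[of "\<lambda>x. f (S x)" x] f
  by (simp add: c multilinear lin_comp[OF f])

text \<open>Counits of \<open>x\<close> and \<open>y\<close> are inserted and merged into one
  pairing with \<open>c\<close>. Then \<open>form_r_antipode\<close> removes \<open>S y\<close>, the
  antipode axiom cancels \<open>S x\<close>, and what remains is the formula of
  \<open>functional_S_eq\<close> for the product.\<close>

lemma S_mult: "S (x \<odot> y) = S y \<odot> S x"
proof (rule functional_eqI)
  fix f assume f: "lin f"
  note lf = multilinear lin_comp[OF f]
  obtain c where c: "\<And>x. form_r c x = \<epsilon> x"
    using lin_counit by (rule functional_as_form_r) blast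
  \<comment> \<open>Here \<open>\<epsilon> x1 * \<epsilon> y1\<close> equals
    \<open>form_r (c \<odot> x1) y1\<close>, because \<open>form_r c\<close> is the multiplicative
    counit and \<open>form_r\<close> is invariant.\<close>
  have key: "\<epsilon> x1 * f (S y \<odot> S x2) =
      D c (\<lambda>a b. D x1 (\<lambda>x11 x12. form_r (a \<odot> x11) y * f (b \<odot> x12 \<odot> S x2)))" for x1 x2
  proof -
    have "\<epsilon> x1 * f (S y \<odot> S x2) = D y (\<lambda>y1 y2. \<epsilon> y1 * (\<epsilon> x1 * f (S y2 \<odot> S x2)))"
      by (subst counit_left) (simp_all add: lf)
    also have "\<dots> = D y (\<lambda>y1 y2. form_r (c \<odot> x1) y1 * f (S y2 \<odot> S x2))"
      by (simp add: form_r_assoc c counit_mult ac_simps)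
    also have "\<dots> = D (c \<odot> x1) (\<lambda>p q. form_r p y * f (q \<odot> S x2))"
      by (rule form_r_antipode) (simp add: lf)
    also have "\<dots> = D c (\<lambda>a b. D x1 (\<lambda>x11 x12. form_r (a \<odot> x11) y * f (b \<odot> x12 \<odot> S x2)))"
      by (rule comult_mult) (simp add: lf)
    finally show ?thesis .
  qed
  have "f (S y \<odot> S x) = D x (\<lambda>x1 x2. \<epsilon> x1 * f (S y \<odot> S x2))"
    by (subst counit_left) (simp_all add: lf)
  also have "\<dots> = D c (\<lambda>a b. D x (\<lambda>x' x3. D x' (\<lambda>x1 x2.
      form_r (a \<odot> x1) y * f (b \<odot> x2 \<odot> S x3))))"
    unfolding key by (rule tensor_apply_swap[OF tensors(1) tensors(1)]) (simp_all add: lf)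
  \<comment> \<open>Coassociativity puts \<open>x2\<close> and \<open>S x3\<close> under one
    coproduct, where the antipode axiom applies.\<close>
  also have "\<dots> = D c (\<lambda>a b. D x (\<lambda>x1 x'. D x' (\<lambda>x2 x3.
      form_r (a \<odot> x1) y * f (b \<odot> (x2 \<odot> S x3)))))"
    by (subst coassoc) (simp_all add: lf trilinear_on_UNIV_iff)
  also have "\<dots> = D c (\<lambda>a b. D x (\<lambda>x1 x'. form_r (a \<odot> x1) y * f b * \<epsilon> x'))"
    by (subst antipode_right) (simp_all add: lf mult.commute)
  also have "\<dots> = D c (\<lambda>a b. form_r (a \<odot> x) y * f b)"
    by (subst counit_right) (simp_all add: lf)
  also have "\<dots> = f (S (x \<odot> y))"
    by (simp add: functional_S_eq[OF f c] form_r_assoc)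
  finally show "f (S (x \<odot> y)) = f (S y \<odot> S x)" by simp
qed

text \<open>\<open>functional_S_eq\<close> eliminates one antipode and
  \<open>form_r_antipode\<close> the other, both in favour of coproducts of \<open>c\<close>.
  Coassociativity regroups these, and \<open>functional_S_eq\<close> is used backwards for the
  functional that sends an element to its coproduct evaluated on \<open>F\<close>.\<close>

lemma S_comult:
  assumes F: "bil F"
  shows "D (S h) F = D h (\<lambda>a b. F (S b) (S a))"
proof -
  note lf = multilinear lin_bil[OF F]
  obtain c where c: "\<And>x. form_r c x = \<epsilon> x"
    using lin_counit by (rule functional_as_form_r) blast
  have key: "F (S b) (S a) = D c (\<lambda>p q. form_r p a * F (S b) q)" for a b
    by (rule functional_S_eq[OF _ c]) (simp add: lf)
  have "D h (\<lambda>a b. F (S b) (S a)) = D c (\<lambda>p q. D h (\<lambda>a b. form_r p a * F (S b) q))"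
    unfolding key by (rule tensor_apply_swap[OF tensors(1) tensors(1)]) (simp_all add: lf)
  also have "\<dots> = D c (\<lambda>p q. D p (\<lambda>p1 p2. form_r p1 h * F p2 q))"
    by (subst form_r_antipode) (simp_all add: lf)
  also have "\<dots> = D c (\<lambda>p1 p'. D p' (\<lambda>p2 q. form_r p1 h * F p2 q))"
    by (rule coassoc) (simp add: lf trilinear_on_UNIV_iff)
  also have "\<dots> = D c (\<lambda>p1 p'. form_r p1 h * D p' F)"
    by (subst tensor_apply_scale[OF tensors(1)]) (simp_all add: F)
  also have "\<dots> = D (S h) F"
    by (rule functional_S_eq[OF _ c, symmetric]) (simp add: lf F)
  finally show ?thesis by simp
qed

section \<open>The associated Hopf algebra seen through \<open>form_r\<close>\<close>

definition "Ht = associated_hopf H form_r g_r form_g g_g"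

lemma Ht_simps [simp]: "hspace Ht = UNIV" "hscale Ht = hscale H"
  "hcounit Ht x = form_r x u"
  by (simp_all add: Ht_def associated_hopf_def whole)

lemma vs_Ht: "vec_space Ht"
  using vs vec_space_eq[of Ht H] by (simp add: whole)

lemma form_r_mult_Ht: "form_r c (hmult Ht x y) = D c (\<lambda>a b. form_r a x * form_r b y)"
proof -
  have bil: "bilinear_on UNIV (hscale H) (hscale H) (\<lambda>a b. hscale H (form_g b y) a)"
    by (rule bilinear_on_flip[OF bil_scale]) (simp add: multilinear)
  have "form_r c (hmult Ht x y) = D x (\<lambda>a b. form_r c (hscale H (form_g b y) a))"
    unfolding Ht_def associated_hopf_def
    by (simp, rule linear_sweedler[OF vs tensors(1) V.vector_space_axioms bil])
      (simp add: multilinear)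
  also have "\<dots> = D x (\<lambda>a b. form_r c a * form_g b y)"
    by (subst lin_scale[of "form_r c"]) (simp_all add: multilinear mult.commute)
  finally show ?thesis by (simp add: form_r_form_g)
qed

text \<open>The metric of \<open>form_g\<close> contracts to the counit when paired by
  \<open>form_g\<close>. Since every \<open>c\<close> is some \<open>S h\<close> and
  \<open>S\<close> preserves the counit, the statement carries over to
  \<open>form_r\<close>.\<close>

lemma form_r_unit_Ht: "form_r c (hunit Ht) = \<epsilon> c"
proof -
  have bil: "bilinear_on UNIV (hscale H) (hscale H) (\<lambda>a b. hscale H (\<epsilon> b) a)"
    by (rule bilinear_on_flip[OF bil_scale[OF lin_counit]])
  have *: "form_g h (hunit Ht) = \<epsilon> h" for h
  proof -
    have "form_g h (hunit Ht) = g_g (\<lambda>a b. form_g h (hscale H (\<epsilon> b) a))"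
      unfolding Ht_def associated_hopf_def
      by (simp, rule linear_sweedler[OF vs tensors(3) V.vector_space_axioms bil])
        (simp add: multilinear)
    also have "\<dots> = g_g (\<lambda>a b. form_g h a * \<epsilon> b)"
      by (subst lin_scale[of "form_g h"]) (simp_all add: multilinear mult.commute)
    also have "\<dots> = \<epsilon> h"
      by (rule metric_of_apply_left[OF vs whole bil_g metric_g lin_counit])
    finally show ?thesis .
  qed
  obtain h where h: "c = S h" using bij_S by (auto simp: bij_def surj_def)
  show ?thesis using *[of h] by (simp add: h form_g_eq counit_S)
qed

lemma
  shows comult_Ht_in: "hcomult Ht x \<in> tensor_square H"
    and comult_Ht_apply: "bil G \<Longrightarrow> hcomult Ht x G = g_r (\<lambda>a b. G a (b \<odot> x))"
proof -
  have bil: "bilinear_on UNIV (hscale H) fun_scale (\<lambda>a b. tens H a (b \<odot> x))"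
    by (rule bilinear_on_compose[OF bilinear_tens]) (simp_all add: multilinear)
  have eq: "hcomult Ht x = sweedler H g_r (\<lambda>a b. tens H a (b \<odot> x))"
    by (simp add: Ht_def associated_hopf_def)
  show "hcomult Ht x \<in> tensor_square H"
    unfolding eq by (rule sweedler_tens_in[OF vs tensors(2) bil]) (simp add: whole)
  show "hcomult Ht x G = g_r (\<lambda>a b. G a (b \<odot> x))" if "bil G"
    unfolding eq by (simp add: sweedler_fun_apply[OF vs tensors(2) bil] tens_apply[OF that])
qed

text \<open>Contracting the metric puts \<open>p\<close> in front of \<open>x\<close>, and
  invariance then collects it to the right of \<open>q\<close>. This reversal is the source of the
  order in condition (a).\<close>

lemma comult_Ht_form_r: "hcomult Ht x (\<lambda>a b. form_r p a * form_r q b) = form_r (q \<odot> p) x"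
proof -
  have "hcomult Ht x (\<lambda>a b. form_r p a * form_r q b) = g_r (\<lambda>a b. form_r p a * form_r q (b \<odot> x))"
    by (rule comult_Ht_apply) (simp add: multilinear)
  also have "\<dots> = form_r q (p \<odot> x)"
    by (rule metric_of_apply_left[OF vs whole bil_r metric_r]) (simp add: multilinear)
  finally show ?thesis by (simp add: form_r_assoc)
qed

text \<open>The coordinate functionals of the dual basis from \<open>g_r\<close> are of the form
  \<open>form_r y\<close>, so these tests determine a tensor.\<close>

lemma comult_Ht_eq_iff:
  assumes t: "t \<in> tensor_square H"
  shows "hcomult Ht x = t \<longleftrightarrow> (\<forall>p q. t (\<lambda>a b. form_r p a * form_r q b) = form_r (q \<odot> p) x)"
proof
  assume *: "\<forall>p q. t (\<lambda>a b. form_r p a * form_r q b) = form_r (q \<odot> p) x"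
  obtain bs where bs: "\<And>v. v = (\<Sum>(w, \<phi>)\<leftarrow>bs. hscale H (\<phi> v) w)"
    "\<And>w \<phi>. (w, \<phi>) \<in> set bs \<Longrightarrow> \<exists>y. \<phi> = form_r y"
    "\<forall>p\<in>set bs. lin (snd p)"
    by (rule metric_of_basis[OF vs whole bil_r metric_r]) blast
  show "hcomult Ht x = t"
  proof (rule tensor_eqI[OF vs comult_Ht_in t bs(1) bs(3)])
    fix w \<phi> w' \<psi> assume "(w, \<phi>) \<in> set bs" "(w', \<psi>) \<in> set bs"
    then obtain p q where "\<phi> = form_r p" "\<psi> = form_r q" using bs(2) by blast
    then show "hcomult Ht x (\<lambda>x y. \<phi> x * \<psi> y) = t (\<lambda>x y. \<phi> x * \<psi> y)"
      using * by (simp add: comult_Ht_form_r)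
  qed
qed (auto simp: comult_Ht_form_r)

section \<open>Hadamard forms as isomorphisms\<close>

lemma dual_simps [simp]:
  "hspace (categorical_dual H) = {\<phi>. lin \<phi>}"
  "hscale (categorical_dual H) = fun_scale"
  "hunit (categorical_dual H) = \<epsilon>"
  "hcounit (categorical_dual H) \<phi> = \<phi> u"
  by (auto simp: categorical_dual_def op_mult_def op_comult_def dual_hopf_def dual_space_def
      zero_ext_def whole)

lemma mult_dual: "lin \<phi> \<Longrightarrow> lin \<psi> \<Longrightarrow>
    hmult (categorical_dual H) \<phi> \<psi> = (\<lambda>x. D x (\<lambda>a b. \<psi> a * \<phi> b))"
  by (auto simp: categorical_dual_def op_mult_def op_comult_def dual_hopf_def zero_ext_def whole
      sweedler_scalar[OF vs tensors(1) bilinear_on_times])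

lemma comult_dual: "hcomult (categorical_dual H) \<phi> =
    tensor_flip (dual_space H) (hcomult (dual_hopf H) \<phi>)"
  using tensor_flip_eq[of "dual_hopf H" "dual_space H"]
  by (simp add: categorical_dual_def op_mult_def op_comult_def dual_hopf_def)

text \<open>The categorical dual carries one flip of the usual dual coproduct;
  \<open>op_comult\<close> flips again and restores the usual one.\<close>

lemma
  assumes \<phi>: "lin \<phi>"
  shows comult_dual_eq_iff: "t \<in> tensor_square (dual_space H) \<Longrightarrow>
      hcomult (categorical_dual H) \<phi> = t \<longleftrightarrow> (\<forall>x y. t (\<lambda>\<alpha> \<beta>. \<beta> x * \<alpha> y) = \<phi> (x \<odot> y))"
    and comult_op_dual_eq_iff: "t \<in> tensor_square (dual_space H) \<Longrightarrow>
      hcomult (op_comult (categorical_dual H)) \<phi> = t \<longleftrightarrow>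
        (\<forall>x y. t (\<lambda>\<alpha> \<beta>. \<alpha> x * \<beta> y) = \<phi> (x \<odot> y))"
proof -
  obtain bs where bs: "\<And>v. v = (\<Sum>(w, \<phi>)\<leftarrow>bs. hscale H (\<phi> v) w)"
    "\<forall>p\<in>set bs. lin (snd p)"
    by (rule metric_of_basis[OF vs whole bil_r metric_r]) blast
  note in_dual = dual_comult_in[OF vs whole bs bil_mult \<phi>]
  note iff = dual_comult_eq_iff[OF vs whole bs bil_mult \<phi>]
  note flip_flip = tensor_flip_flip[OF vec_space_dual]
  assume t: "t \<in> tensor_square (dual_space H)"
  have "hcomult (categorical_dual H) \<phi> = t \<longleftrightarrow>
      hcomult (dual_hopf H) \<phi> = tensor_flip (dual_space H) t"
    unfolding comult_dual using flip_flip[OF t] flip_flip[OF in_dual] by metis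
  also have "\<dots> \<longleftrightarrow> (\<forall>x y. tensor_flip (dual_space H) t (\<lambda>\<alpha> \<beta>. \<alpha> x * \<beta> y) = \<phi> (x \<odot> y))"
    by (rule iff[OF tensor_flip_in[OF vec_space_dual t]])
  also have "\<dots> \<longleftrightarrow> (\<forall>x y. t (\<lambda>\<alpha> \<beta>. \<beta> x * \<alpha> y) = \<phi> (x \<odot> y))"
    by (subst tensor_flip_apply[OF vec_space_dual t])
      (simp_all add: dual_space_def bilinear_on_times linear_on_apply)
  finally show "hcomult (categorical_dual H) \<phi> = t \<longleftrightarrow>
    (\<forall>x y. t (\<lambda>\<alpha> \<beta>. \<beta> x * \<alpha> y) = \<phi> (x \<odot> y))" .
  have "hcomult (op_comult (categorical_dual H)) \<phi> = hcomult (dual_hopf H) \<phi>"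
    using tensor_flip_eq[of "categorical_dual H" "dual_space H"] flip_flip[OF in_dual]
    by (simp add: op_comult_def comult_dual dual_space_def whole)
  then show "hcomult (op_comult (categorical_dual H)) \<phi> = t \<longleftrightarrow>
      (\<forall>x y. t (\<lambda>\<alpha> \<beta>. \<alpha> x * \<beta> y) = \<phi> (x \<odot> y))"
    using iff[OF t] by simp
qed

lemma
  assumes f: "bil f"
  shows tensor_map_dual_in: "tensor_map H (dual_space H) f (D x) \<in> tensor_square (dual_space H)"
    and tensor_map_dual_apply: "bilinear_on UNIV fun_scale (*) G \<Longrightarrow>
      tensor_map H (dual_space H) f (D x) G = D x (\<lambda>a b. G (f a) (f b))"
proof -
  have scale: "hscale (dual_space H) = fun_scale" by (simp add: dual_space_def)
  have lin: "linear_on UNIV (hscale H) (hscale (dual_space H)) f"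
    using f by (auto simp: scale bilinear_on_def linear_on_def fun_eq_iff)
  show "tensor_map H (dual_space H) f (D x) \<in> tensor_square (dual_space H)"
    using f by (intro tensor_map_in[OF vs tensors(1) lin])
      (auto simp: hspace_dual_UNIV[OF whole] bilinear_on_UNIV)
  show "tensor_map H (dual_space H) f (D x) G = D x (\<lambda>a b. G (f a) (f b))"
    if "bilinear_on UNIV fun_scale (*) G"
    by (rule tensor_map_apply[OF vs tensors(1) lin]) (simp add: scale that)
qed

lemma bil_linear: "bil f \<Longrightarrow> linear_on UNIV (hscale H) fun_scale f"
  by (auto simp: bilinear_on_def linear_on_def fun_eq_iff)

text \<open>Tensors over the dual are tested on evaluations at \<open>y\<close> and
  \<open>z\<close>. The flip of the categorical dual decides whether the legs of \<open>D x\<close>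
  come out as in (b') or as in (b'').\<close>

lemma comult_map_dual_iff:
  assumes f: "bil f"
  shows "hcomult (categorical_dual H) (f x) = tensor_map H (dual_space H) f (D x) \<longleftrightarrow>
      (\<forall>y z. f x (y \<odot> z) = D x (\<lambda>a b. f b y * f a z))" (is ?flip)
    and "hcomult (op_comult (categorical_dual H)) (f x) = tensor_map H (dual_space H) f (D x) \<longleftrightarrow>
      (\<forall>y z. f x (y \<odot> z) = D x (\<lambda>a b. f a y * f b z))" (is ?noflip)
proof -
  have fx: "lin (f x)" using f by (simp add: bilinear_on_UNIV)
  have bil: "bilinear_on UNIV fun_scale (*) (\<lambda>\<alpha> \<beta>. \<alpha> y * \<beta> z)"
    "bilinear_on UNIV fun_scale (*) (\<lambda>\<alpha> \<beta>. \<beta> y * \<alpha> z)" for y z :: 'h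
    using bilinear_on_times[OF linear_on_apply linear_on_apply] by (simp_all add: mult.commute)
  show ?flip
    by (subst comult_dual_eq_iff[OF fx tensor_map_dual_in[OF f]])
      (auto simp: tensor_map_dual_apply[OF f bil(2)])
  show ?noflip
    by (subst comult_op_dual_eq_iff[OF fx tensor_map_dual_in[OF f]])
      (auto simp: tensor_map_dual_apply[OF f bil(1)])
qed

text \<open>The product clause of \<open>hopf_iso\<close> gives the condition of type (a), the
  coproduct clause that of type (b). Taking the opposite product reverses the former, taking the
  opposite coproduct the latter.\<close>

lemma
  assumes f: "bil f"
  shows hopf_iso_dual_iff: "hopf_iso H (categorical_dual H) f \<longleftrightarrow>
      bij_betw f UNIV {\<phi>. lin \<phi>} \<and>
      (\<forall>x y z. f (x \<odot> y) z = D z (\<lambda>a b. f y a * f x b)) \<and> (\<forall>x. f u x = \<epsilon> x) \<and>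
      (\<forall>x y z. f x (y \<odot> z) = D x (\<lambda>a b. f b y * f a z)) \<and> (\<forall>x. f x u = \<epsilon> x)"
    and hopf_iso_op_mult_dual_iff: "hopf_iso H (op_mult (categorical_dual H)) f \<longleftrightarrow>
      bij_betw f UNIV {\<phi>. lin \<phi>} \<and>
      (\<forall>x y z. f (x \<odot> y) z = D z (\<lambda>a b. f x a * f y b)) \<and> (\<forall>x. f u x = \<epsilon> x) \<and>
      (\<forall>x y z. f x (y \<odot> z) = D x (\<lambda>a b. f b y * f a z)) \<and> (\<forall>x. f x u = \<epsilon> x)"
    and hopf_iso_op_comult_dual_iff: "hopf_iso H (op_comult (categorical_dual H)) f \<longleftrightarrow>
      bij_betw f UNIV {\<phi>. lin \<phi>} \<and>
      (\<forall>x y z. f (x \<odot> y) z = D z (\<lambda>a b. f y a * f x b)) \<and> (\<forall>x. f u x = \<epsilon> x) \<and>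
      (\<forall>x y z. f x (y \<odot> z) = D x (\<lambda>a b. f a y * f b z)) \<and> (\<forall>x. f x u = \<epsilon> x)"
proof -
  have fx: "lin (f x)" for x using f by (simp add: bilinear_on_UNIV)
  have ext: "f (x \<odot> y) = g \<longleftrightarrow> (\<forall>z. f (x \<odot> y) z = g z)" "f u = g \<longleftrightarrow> (\<forall>z. f u z = g z)"
    for x y g
    by (simp_all add: fun_eq_iff)
  have eq: "tensor_map H (categorical_dual H) f = tensor_map H (dual_space H) f"
    "tensor_map H (op_mult (categorical_dual H)) f = tensor_map H (dual_space H) f"
    "tensor_map H (op_comult (categorical_dual H)) f = tensor_map H (dual_space H) f"
    by (subst tensor_map_eq_cod[of _ "dual_space H"];
      simp add: op_mult_def op_comult_def dual_space_def whole)+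
  show "hopf_iso H (categorical_dual H) f \<longleftrightarrow>
      bij_betw f UNIV {\<phi>. lin \<phi>} \<and>
      (\<forall>x y z. f (x \<odot> y) z = D z (\<lambda>a b. f y a * f x b)) \<and> (\<forall>x. f u x = \<epsilon> x) \<and>
      (\<forall>x y z. f x (y \<odot> z) = D x (\<lambda>a b. f b y * f a z)) \<and> (\<forall>x. f x u = \<epsilon> x)"
    unfolding hopf_iso_def whole eq
    by (auto simp: bil_linear[OF f] comult_map_dual_iff(1)[OF f] mult_dual fx ext)
  show "hopf_iso H (op_mult (categorical_dual H)) f \<longleftrightarrow>
      bij_betw f UNIV {\<phi>. lin \<phi>} \<and>
      (\<forall>x y z. f (x \<odot> y) z = D z (\<lambda>a b. f x a * f y b)) \<and> (\<forall>x. f u x = \<epsilon> x) \<and>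
      (\<forall>x y z. f x (y \<odot> z) = D x (\<lambda>a b. f b y * f a z)) \<and> (\<forall>x. f x u = \<epsilon> x)"
    unfolding hopf_iso_def whole eq
    by (auto simp: bil_linear[OF f] comult_map_dual_iff(1)[OF f] mult_dual fx ext)
  show "hopf_iso H (op_comult (categorical_dual H)) f \<longleftrightarrow>
      bij_betw f UNIV {\<phi>. lin \<phi>} \<and>
      (\<forall>x y z. f (x \<odot> y) z = D z (\<lambda>a b. f y a * f x b)) \<and> (\<forall>x. f u x = \<epsilon> x) \<and>
      (\<forall>x y z. f x (y \<odot> z) = D x (\<lambda>a b. f a y * f b z)) \<and> (\<forall>x. f x u = \<epsilon> x)"
    unfolding hopf_iso_def whole eq
    \<comment> \<open>The opposite coproduct stays folded, since
      \<open>comult_map_dual_iff(2)\<close> speaks of it in that form.\<close>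
    by (auto simp: bil_linear[OF f] comult_map_dual_iff(2)[OF f] mult_dual fx ext
        simp del: op_comult_simps(5))
qed

section \<open>Hadamard forms as maps into the dual\<close>

lemma nondegenerate_iff_bij:
  assumes f: "bil f"
  shows "nondegenerate H f \<longleftrightarrow> bij_betw f UNIV {\<phi>. lin \<phi>}"
proof -
  obtain bs where bs: "\<And>v. v = (\<Sum>(w, \<phi>)\<leftarrow>bs. hscale H (\<phi> v) w)"
    "\<forall>p\<in>set bs. lin (snd p)"
    by (rule metric_of_basis[OF vs whole bil_r metric_r]) blast
  show ?thesis
    using nondegenerate_bij[OF vs whole f] bij_nondegenerate[OF vs whole f bs]
    unfolding hspace_dual_UNIV[OF whole] by blast
qed

lemma nondegenerate_iff_bij_flip:
  assumes f: "bil f"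
  shows "nondegenerate H f \<longleftrightarrow> bij_betw (\<lambda>x y. f y x) UNIV {\<phi>. lin \<phi>}"
  using nondegenerate_flip[OF vs whole f] nondegenerate_flip[OF vs whole bilinear_on_flip[OF f]]
    nondegenerate_iff_bij[OF bilinear_on_flip[OF f]] by auto

text \<open>The clauses are ordered and oriented as in \<open>hopf_iso_dual_iff\<close>, so that
  both sides can be compared verbatim.\<close>

lemma
  assumes T: "bil \<Theta>"
  shows hadamard_type2_iff: "hadamard_type2 H \<Theta> \<longleftrightarrow> nondegenerate H \<Theta> \<and>
      (\<forall>x y z. \<Theta> (x \<odot> y) z = D z (\<lambda>a b. \<Theta> y a * \<Theta> x b)) \<and> (\<forall>x. \<Theta> u x = \<epsilon> x) \<and>
      (\<forall>x y z. \<Theta> x (y \<odot> z) = D x (\<lambda>a b. \<Theta> b y * \<Theta> a z)) \<and> (\<forall>x. \<Theta> x u = \<epsilon> x)"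
    and hadamard_type3_iff: "hadamard_type3 H \<Theta> \<longleftrightarrow> nondegenerate H \<Theta> \<and>
      (\<forall>x y z. \<Theta> (x \<odot> y) z = D z (\<lambda>a b. \<Theta> y a * \<Theta> x b)) \<and> (\<forall>x. \<Theta> u x = \<epsilon> x) \<and>
      (\<forall>x y z. \<Theta> x (y \<odot> z) = D x (\<lambda>a b. \<Theta> a y * \<Theta> b z)) \<and> (\<forall>x. \<Theta> x u = \<epsilon> x)"
proof -
  have bil: "bil (\<lambda>a b. \<Theta> x b * \<Theta> y a)" "bil (\<lambda>a b. \<Theta> b x * \<Theta> a y)"
    "bil (\<lambda>a b. \<Theta> a x * \<Theta> b y)" for x y
    using T by (simp_all add: bilinear_on_UNIV lin_times)
  show "hadamard_type2 H \<Theta> \<longleftrightarrow> nondegenerate H \<Theta> \<and>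
      (\<forall>x y z. \<Theta> (x \<odot> y) z = D z (\<lambda>a b. \<Theta> y a * \<Theta> x b)) \<and> (\<forall>x. \<Theta> u x = \<epsilon> x) \<and>
      (\<forall>x y z. \<Theta> x (y \<odot> z) = D x (\<lambda>a b. \<Theta> b y * \<Theta> a z)) \<and> (\<forall>x. \<Theta> x u = \<epsilon> x)"
    unfolding hadamard_type2_def hadamard_form_common_def whole
      sweedler_scalar[OF vs tensors(1) bil(1)] sweedler_scalar[OF vs tensors(1) bil(2)]
    by (auto simp: mult.commute)
  show "hadamard_type3 H \<Theta> \<longleftrightarrow> nondegenerate H \<Theta> \<and>
      (\<forall>x y z. \<Theta> (x \<odot> y) z = D z (\<lambda>a b. \<Theta> y a * \<Theta> x b)) \<and> (\<forall>x. \<Theta> u x = \<epsilon> x) \<and>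
      (\<forall>x y z. \<Theta> x (y \<odot> z) = D x (\<lambda>a b. \<Theta> a y * \<Theta> b z)) \<and> (\<forall>x. \<Theta> x u = \<epsilon> x)"
    unfolding hadamard_type3_def hadamard_form_common_def whole
      sweedler_scalar[OF vs tensors(1) bil(1)] sweedler_scalar[OF vs tensors(1) bil(3)]
    by (auto simp: mult.commute)
qed

text \<open>\<open>S\<close> is a bijection that reverses products and coproducts and fixes unit and
  counit. Precomposing with it therefore trades the order conditions for the opposite product
  against those of Type 3.\<close>

lemma hadamard_type3_iff_hopf_iso_antipode:
  assumes T: "bil \<Theta>"
  shows "hadamard_type3 H \<Theta> \<longleftrightarrow> hopf_iso H (op_mult (categorical_dual H)) (\<lambda>h. \<Theta> (S h))"
proof -
  have f: "bil (\<lambda>h. \<Theta> (S h))"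
    using lin_bil[OF T] by (simp add: multilinear)
  \<comment> \<open>Surjectivity of \<open>S\<close> allows \<open>S x\<close> to be replaced by an
    arbitrary element.\<close>
  have surj: "(\<forall>x. P (S x)) \<longleftrightarrow> (\<forall>x. P x)" for P
    using bij_S by (metis bij_pointE)
  have bij: "bij_betw (\<lambda>h. \<Theta> (S h)) UNIV {\<phi>. lin \<phi>} \<longleftrightarrow> bij_betw \<Theta> UNIV {\<phi>. lin \<phi>}"
    using bij_betw_comp_iff[OF bij_S, of \<Theta> "{\<phi>. lin \<phi>}"] by (simp add: comp_def)
  have "(\<forall>x y z. \<Theta> (S (x \<odot> y)) z = D z (\<lambda>a b. \<Theta> (S x) a * \<Theta> (S y) b)) \<longleftrightarrow>
      (\<forall>x y z. \<Theta> (S y \<odot> S x) z = D z (\<lambda>a b. \<Theta> (S x) a * \<Theta> (S y) b))"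
    by (simp add: S_mult)
  also have "\<dots> \<longleftrightarrow> (\<forall>x y z. \<Theta> (x \<odot> y) z = D z (\<lambda>a b. \<Theta> y a * \<Theta> x b))"
    using surj[of "\<lambda>x. \<forall>y z. \<Theta> (S y \<odot> x) z = D z (\<lambda>a b. \<Theta> x a * \<Theta> (S y) b)"]
      surj[of "\<lambda>y. \<Theta> (y \<odot> x) z = D z (\<lambda>a b. \<Theta> x a * \<Theta> y b)" for x z]
    by blast
  finally have mult: "(\<forall>x y z. \<Theta> (S (x \<odot> y)) z = D z (\<lambda>a b. \<Theta> (S x) a * \<Theta> (S y) b)) \<longleftrightarrow>
      (\<forall>x y z. \<Theta> (x \<odot> y) z = D z (\<lambda>a b. \<Theta> y a * \<Theta> x b))" .
  have "D x (\<lambda>a b. \<Theta> (S b) y * \<Theta> (S a) z) = D (S x) (\<lambda>a b. \<Theta> a y * \<Theta> b z)" for x y z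
    by (rule S_comult[symmetric]) (use T in \<open>simp add: bilinear_on_UNIV lin_times\<close>)
  then have comult: "(\<forall>x y z. \<Theta> (S x) (y \<odot> z) = D x (\<lambda>a b. \<Theta> (S b) y * \<Theta> (S a) z)) \<longleftrightarrow>
      (\<forall>x y z. \<Theta> x (y \<odot> z) = D x (\<lambda>a b. \<Theta> a y * \<Theta> b z))"
    using surj[of "\<lambda>x. \<forall>y z. \<Theta> x (y \<odot> z) = D x (\<lambda>a b. \<Theta> a y * \<Theta> b z)"] by simp
  have counit: "(\<forall>x. \<Theta> (S x) u = \<epsilon> x) \<longleftrightarrow> (\<forall>x. \<Theta> x u = \<epsilon> x)"
    using surj[of "\<lambda>x. \<Theta> x u = \<epsilon> x"] by (simp add: counit_S)
  show ?thesis
    unfolding hopf_iso_op_mult_dual_iff[OF f] hadamard_type3_iff[OF T] nondegenerate_iff_bij[OF T]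
      bij mult comult counit S_unit ..
qed

text \<open>Exchanging the arguments of \<open>\<Theta>\<close> exchanges the roles of (a) and
  (b''), and with them the product and coproduct clauses.\<close>

lemma hadamard_type3_iff_hopf_iso_flip:
  assumes T: "bil \<Theta>"
  shows "hadamard_type3 H \<Theta> \<longleftrightarrow> hopf_iso H (op_mult (categorical_dual H)) (\<lambda>h x. \<Theta> x h)"
  unfolding hopf_iso_op_mult_dual_iff[OF bilinear_on_flip[OF T]] hadamard_type3_iff[OF T]
    nondegenerate_iff_bij_flip[OF T]
  by (auto simp: mult.commute)

section \<open>The Hadamard map into the associated Hopf algebra\<close>

lemma form_r_hadamard_map:
  assumes T: "bil \<Theta>"
  shows "form_r a (hadamard_map H g_r \<Theta> h) = \<Theta> a h"
proof -
  have T1: "lin (\<lambda>y. \<Theta> y h)" using T by (simp add: bilinear_on_UNIV)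
  have "form_r a (hadamard_map H g_r \<Theta> h) = g_r (\<lambda>x y. form_r a (hscale H (\<Theta> y h) x))"
    unfolding hadamard_map_def
    by (rule linear_sweedler[OF vs tensors(2) V.vector_space_axioms
          bilinear_on_flip[OF bil_scale[OF T1]]]) (simp add: multilinear)
  also have "\<dots> = g_r (\<lambda>x y. form_r a x * \<Theta> y h)"
    by (subst lin_scale[of "form_r a"]) (simp_all add: multilinear mult.commute)
  also have "\<dots> = \<Theta> a h"
    by (rule metric_of_apply_left[OF vs whole bil_r metric_r T1])
  finally show ?thesis .
qed

text \<open>Followed by the bijection of \<open>H\<close> with its dual that puts \<open>x\<close>
  into the second slot of \<open>form_r\<close>, the Hadamard map becomes \<open>\<Theta>\<close>
  with \<open>h\<close> in its second slot. Linearity and bijectivity are read off there.\<close>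

lemma
  assumes T: "bil \<Theta>"
  shows endo_hadamard_map: "endo (hadamard_map H g_r \<Theta>)"
    and bij_hadamard_map: "bij (hadamard_map H g_r \<Theta>) \<longleftrightarrow> nondegenerate H \<Theta>"
proof -
  note form = form_r_hadamard_map[OF T]
  have lin: "form_r a (x + y) = form_r a x + form_r a y" "form_r a (hscale H c x) = c * form_r a x"
    "\<Theta> a (x + y) = \<Theta> a x + \<Theta> a y" "\<Theta> a (hscale H c x) = c * \<Theta> a x" for a x y c
    using T bil_r by (simp_all add: bilinear_on_def linear_on_def)
  show "endo (hadamard_map H g_r \<Theta>)"
    unfolding linear_on_def
    by (intro conjI ballI allI form_r_eqI_right) (simp_all add: form lin)
  have "bij_betw (\<lambda>x y. form_r y x) UNIV {\<phi>. lin \<phi>}"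
    using nondegenerate_iff_bij_flip[OF bil_r] metric_r by (auto simp: nondegenerate_def)
  from bij_betw_comp_iff2[OF this, of "hadamard_map H g_r \<Theta>" UNIV]
  show "bij (hadamard_map H g_r \<Theta>) \<longleftrightarrow> nondegenerate H \<Theta>"
    by (simp add: comp_def form nondegenerate_iff_bij_flip[OF T])
qed

lemma comult_Ht_map_iff:
  assumes T: "bil \<Theta>"
  shows "hcomult Ht (hadamard_map H g_r \<Theta> z) = tensor_map H H (hadamard_map H g_r \<Theta>) (D z) \<longleftrightarrow>
    (\<forall>x y. \<Theta> (x \<odot> y) z = D z (\<lambda>a b. \<Theta> y a * \<Theta> x b))"
proof -
  note endo = endo_hadamard_map[OF T]
  have t: "tensor_map H H (hadamard_map H g_r \<Theta>) (D z) \<in> tensor_square H"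
    by (rule tensor_map_in[OF vs tensors(1) endo]) (simp add: whole)
  have "tensor_map H H (hadamard_map H g_r \<Theta>) (D z) (\<lambda>a b. form_r p a * form_r q b) =
      D z (\<lambda>a b. \<Theta> p a * \<Theta> q b)" for p q
    by (subst tensor_map_apply[OF vs tensors(1) endo])
      (simp_all add: multilinear form_r_hadamard_map[OF T])
  then show ?thesis
    unfolding comult_Ht_eq_iff[OF t] form_r_hadamard_map[OF T] by auto
qed

text \<open>Each clause of \<open>hopf_iso\<close> is tested with \<open>form_r a\<close>: the
  coproduct clause becomes (a), the product clause (b'') or, for the opposite product, (b'), and the
  unit and counit clauses the two normalisations of \<open>\<Theta>\<close>.\<close>

lemma
  assumes T: "bil \<Theta>"
  shows hopf_iso_Ht_iff: "hopf_iso H Ht (hadamard_map H g_r \<Theta>) \<longleftrightarrow> hadamard_type3 H \<Theta>"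
    and hopf_iso_op_Ht_iff: "hopf_iso H (op_mult Ht) (hadamard_map H g_r \<Theta>) \<longleftrightarrow> hadamard_type2 H \<Theta>"
proof -
  let ?h = "hadamard_map H g_r \<Theta>"
  note form = form_r_hadamard_map[OF T]
  have eq: "tensor_map H Ht f = tensor_map H H f" "tensor_map H (op_mult Ht) f = tensor_map H H f" for f
    by (subst tensor_map_eq_cod[of _ H]; simp add: op_mult_def whole)+
  have test: "x = y \<longleftrightarrow> (\<forall>a. form_r a x = form_r a y)" for x y
    using form_r_eqI_right by blast
  \<comment> \<open>The counit of \<open>Ht\<close> has \<open>u\<close> in the second slot, whereas
    the Hadamard map is tested in the first.\<close>
  have one: "form_r u a = form_r a u" for a
    using form_r_assoc[of u a u] by simp
  have mult: "(\<forall>x y. ?h (x \<odot> y) = hmult Ht (?h x) (?h y)) \<longleftrightarrow>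
      (\<forall>x y z. \<Theta> x (y \<odot> z) = D x (\<lambda>a b. \<Theta> a y * \<Theta> b z))"
    unfolding test form form_r_mult_Ht by blast
  have mult_op: "(\<forall>x y. ?h (x \<odot> y) = hmult Ht (?h y) (?h x)) \<longleftrightarrow>
      (\<forall>x y z. \<Theta> x (y \<odot> z) = D x (\<lambda>a b. \<Theta> b y * \<Theta> a z))"
    unfolding test form form_r_mult_Ht by (auto simp: mult.commute)
  have unit: "?h u = hunit Ht \<longleftrightarrow> (\<forall>x. \<Theta> x u = \<epsilon> x)"
    unfolding test form form_r_unit_Ht ..
  have counit: "hcounit Ht (?h x) = \<epsilon> x \<longleftrightarrow> \<Theta> u x = \<epsilon> x" for x
    using form[of u x] by (simp add: one)
  show "hopf_iso H Ht ?h \<longleftrightarrow> hadamard_type3 H \<Theta>"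
    unfolding hopf_iso_def hadamard_type3_iff[OF T] whole eq ball_UNIV comult_Ht_map_iff[OF T]
      mult unit counit Ht_simps(1,2) bij_hadamard_map[OF T]
    using endo_hadamard_map[OF T] by blast
  show "hopf_iso H (op_mult Ht) ?h \<longleftrightarrow> hadamard_type2 H \<Theta>"
    unfolding hopf_iso_def hadamard_type2_iff[OF T] whole eq ball_UNIV
      op_mult_simps comult_Ht_map_iff[OF T] mult_op unit counit Ht_simps(1,2) bij_hadamard_map[OF T]
    using endo_hadamard_map[OF T] by blast
qed

lemma hopf_transport_Ht_iff:
  "hopf_transport H Ht f \<longleftrightarrow> hopf_iso H Ht f"
  "hopf_transport H (op_mult Ht) f \<longleftrightarrow> hopf_iso H (op_mult Ht) f"
proof -
  have "hspace (op_mult Ht) = hspace H" "hscale (op_mult Ht) = hscale H"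
    "hcomult (op_mult Ht) = hcomult Ht" by (simp_all add: op_mult_def whole)
  then have eqs: "vec_space (op_mult Ht)" "hspace (op_mult Ht) = UNIV"
    "\<And>x. hcomult (op_mult Ht) x \<in> tensor_square (op_mult Ht)"
    "\<And>x. hcomult Ht x \<in> tensor_square Ht"
    using vs vec_space_eq[of "op_mult Ht" H] comult_Ht_in
      tensor_square_eq[of "op_mult Ht" H] tensor_square_eq[of Ht H]
    by (simp_all add: whole)
  show "hopf_transport H Ht f \<longleftrightarrow> hopf_iso H Ht f"
    "hopf_transport H (op_mult Ht) f \<longleftrightarrow> hopf_iso H (op_mult Ht) f"
    by (intro hopf_transport_iff_hopf_iso vs whole tensors(1) vs_Ht Ht_simps(1) eqs)+
qed

end

theorem lemma3p13:
  fixes H Ht :: "('k::field, 'h::ab_group_add) hopf_data"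
    and S hh :: "'h \<Rightarrow> 'h"
    and form_r form_g \<Theta> :: "'h \<Rightarrow> 'h \<Rightarrow> 'k"
    and g_r g_g :: "('k, 'h) tensor"
  assumes whole_type: "hspace H = UNIV"
    and hopf: "hopf_algebra H S"
    and frob_r: "frobenius_algebra H form_r g_r"
    and frob_g: "frobenius_coalgebra H form_g g_g"
    and antipode: "\<And>h. S h = sweedler H g_r (\<lambda>x y. hscale H (form_g h x) y)"
    and Ht: "Ht = associated_hopf H form_r g_r form_g g_g"
    and Theta: "form_on H \<Theta>"
    and hh: "hh = hadamard_map H g_r \<Theta>"
  shows
    "(hadamard_type2 H \<Theta> \<longleftrightarrow> hopf_iso H (categorical_dual H) (\<lambda>h. \<Theta> h)) \<and>
     (hadamard_type2 H \<Theta> \<longleftrightarrow> hopf_iso H (op_mult Ht) hh) \<and>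
     (hadamard_type2 H \<Theta> \<longleftrightarrow> hopf_transport H (op_mult Ht) hh) \<and>
     (hadamard_type3 H \<Theta> \<longleftrightarrow> hopf_iso H (op_comult (categorical_dual H)) (\<lambda>h. \<Theta> h)) \<and>
     (hadamard_type3 H \<Theta> \<longleftrightarrow> hopf_iso H (op_mult (categorical_dual H)) (\<lambda>h. \<Theta> (S h))) \<and>
     (hadamard_type3 H \<Theta> \<longleftrightarrow> hopf_iso H (op_mult (categorical_dual H)) (\<lambda>h x. \<Theta> x h)) \<and>
     (hadamard_type3 H \<Theta> \<longleftrightarrow> hopf_iso H Ht hh) \<and>
     (hadamard_type3 H \<Theta> \<longleftrightarrow> hopf_transport H Ht hh)"
proof -
  interpret F: frobenius_hopf H S form_r form_g g_r g_g
    using whole_type hopf frob_r frob_g antipode by unfold_locales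
  have T: "bilinear_on UNIV (hscale H) (*) \<Theta>"
    using Theta by (simp add: whole_type)
  have Ht': "Ht = F.Ht" by (simp add: Ht F.Ht_def)
  have type2: "hadamard_type2 H \<Theta> \<longleftrightarrow> hopf_iso H (categorical_dual H) \<Theta>"
    and type3: "hadamard_type3 H \<Theta> \<longleftrightarrow> hopf_iso H (op_comult (categorical_dual H)) \<Theta>"
    \<comment> \<open>Unfolded, both sides of each equivalence are the same conjunction.\<close>
    unfolding F.hopf_iso_dual_iff[OF T] F.hopf_iso_op_comult_dual_iff[OF T]
      F.hadamard_type2_iff[OF T] F.hadamard_type3_iff[OF T] F.nondegenerate_iff_bij[OF T] by (rule refl)+
  show ?thesis
    \<comment> \<open>The clauses about \<open>hh\<close> turn into trivial equivalences; only those
      about the dual remain.\<close>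
    unfolding Ht' hh F.hopf_transport_Ht_iff F.hopf_iso_Ht_iff[OF T] F.hopf_iso_op_Ht_iff[OF T]
    using type2 type3 F.hadamard_type3_iff_hopf_iso_antipode[OF T] F.hadamard_type3_iff_hopf_iso_flip[OF T] by blast
qed

end
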